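(* Let $n,d\in\mathbb N$, $d\ge2$, $u\in\mathcal U^n(\mathbb R)$, $f:=-\mathrm{abs}*u$, $F:=\mathcal I_d[f]$ and $\Phi(x):=F(\|x\|)$ for $x\in\mathbb R^d$. Then: (i) $\Phi\in\mathrm{CP}_1(\mathbb R^d)$; (ii) $\Phi(x)<0$ for all $x\in\mathbb R^d$; (iii) $\Phi(x)=-C_d\|x\|+\varphi(\|x\|)$ for some $\varphi\in\mathcal C_0(\mathbb R)$ with $\varphi(s)=\mathcal O(1/s)$ as $s\to\infty$, where $C_d=\frac{\Gamma(d/2)}{\sqrt\pi\Gamma(\frac{d+1}{2})}$; (iv) $\Phi\in\mathcal C^{n+2}(\mathbb R^d)$; (v) $\nabla\Phi$ is Lipschitz continuous with constant $L:=2\sqrt d\,\|u\|_\infty$; (vi) $\Phi$ is concave, and for all $\lambda\in[0,1]$, $x,y\in\mathbb R^d$, $$\Phi(\lambda x+(1-\lambda)y)\le\lambda\Phi(x)+(1-\lambda)\Phi(y)+\tfrac L2\lambda(1-\lambda)\|x-y\|^2.$$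
   Context: $\mathrm{abs}(x)=|x|$. $\mathcal U^n(\mathbb R):=\{u\in\mathcal C^n_c(\mathbb R):u\ge0,\ \hat u\ge0,\ u\text{ even},\ \int u=1\}$ with $\hat u(\omega)=\int e^{-2\pi ix\omega}u(x)\mathrm dx$. $\mathcal I_d[f](s):=c_d\int_0^1f(ts)(1-t^2)^{\frac{d-3}{2}}\mathrm dt$, $c_d:=2w_{d-2}/w_{d-1}$, $w_{d-1}:=2\pi^{d/2}/\Gamma(d/2)$. $\mathrm{CP}_1(\mathbb R^d)$: continuous even $g$ with $\sum_{j,k}a_j\bar a_kg(x_j-x_k)\ge0$ for all points $x_1,\dots,x_N\in\mathbb R^d$ and all $a\in\mathbb C^N\setminus\{0\}$ with $\sum_ja_j=0$. *)

theory Defs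
  imports "HOL-Analysis.Analysis" "HOL-Library.Landau_Symbols"
begin

text \<open>C^k for real-valued functions on a Euclidean space: C^0 = continuous;
  C^(k+1) = differentiable everywhere with all partial derivatives (along the
  standard basis) of class C^k. For the real line the only basis vector is 1,
  so the partial derivative is the ordinary derivative.\<close>
fun Ck :: "nat \<Rightarrow> ('a::euclidean_space \<Rightarrow> real) \<Rightarrow> bool" where
  "Ck 0 f = continuous_on UNIV f"
| "Ck (Suc k) f = ((\<forall>x. f differentiable (at x)) \<and>
      (\<forall>b\<in>Basis. Ck k (\<lambda>x. frechet_derivative f (at x) b)))"

definition fourier :: "(real \<Rightarrow> real) \<Rightarrow> real \<Rightarrow> complex" where
  "fourier u w = integral UNIV (\<lambda>x. exp (- 2 * pi * \<i> * complex_of_real (x * w)) * complex_of_real (u x))"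

definition U_class :: "nat \<Rightarrow> (real \<Rightarrow> real) set" where
  "U_class n = {u. Ck n u \<and> compact (closure {x. u x \<noteq> 0})
      \<and> (\<forall>x. u x \<ge> 0)
      \<and> (\<forall>w. Im (fourier u w) = 0 \<and> Re (fourier u w) \<ge> 0)
      \<and> (\<forall>x. u (- x) = u x)
      \<and> u integrable_on UNIV \<and> integral UNIV u = 1}"

definition abs_conv :: "(real \<Rightarrow> real) \<Rightarrow> real \<Rightarrow> real" where
  "abs_conv u s = integral UNIV (\<lambda>t. \<bar>s - t\<bar> * u t)"

text \<open>w_k = surface area of the unit sphere S^k in R^(k+1):  w_(d-1) = 2 pi^(d/2) / Gamma(d/2).\<close>
definition sphere_area :: "nat \<Rightarrow> real" where
  "sphere_area k = 2 * pi powr ((real k + 1) / 2) / Gamma ((real k + 1) / 2)"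

definition c_const :: "nat \<Rightarrow> real" where
  "c_const d = 2 * sphere_area (d - 2) / sphere_area (d - 1)"

definition I_op :: "nat \<Rightarrow> (real \<Rightarrow> real) \<Rightarrow> real \<Rightarrow> real" where
  "I_op d f s = c_const d * integral {0..1} (\<lambda>t. f (t * s) * (1 - t\<^sup>2) powr ((real d - 3) / 2))"

definition CP1 :: "('a::euclidean_space \<Rightarrow> real) set" where
  "CP1 = {g. continuous_on UNIV g \<and> (\<forall>x. g (- x) = g x) \<and>
     (\<forall>(N::nat) (x::nat \<Rightarrow> 'a) (a::nat \<Rightarrow> complex).
        (\<exists>j<N. a j \<noteq> 0) \<and> (\<Sum>j<N. a j) = 0 \<longrightarrow>
        (let S = (\<Sum>j<N. \<Sum>k<N. a j * cnj (a k) * complex_of_real (g (x j - x k)))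
         in Im S = 0 \<and> Re S \<ge> 0))}"

definition grad :: "(real^'d \<Rightarrow> real) \<Rightarrow> real^'d \<Rightarrow> real^'d" where
  "grad f x = (\<chi> i. frechet_derivative f (at x) (axis i 1))"

definition sup_norm :: "(real \<Rightarrow> real) \<Rightarrow> real" where
  "sup_norm u = (SUP x. \<bar>u x\<bar>)"

end

theory Submission
  imports Defs "HOL-Probability.Sinc_Integral"
begin

text \<open>With \<open>\<xi>\<close> uniform on the unit sphere, \<open>\<Phi> x\<close> is the mean of \<open>f (x \<bullet> \<xi>)\<close>, so (i), (ii), (iv), (v) and (vi)
  are inherited from \<open>f\<close>: here \<open>f'' = - 2 u\<close>, and \<open>f\<close> is conditionally positive definite because
  \<open>\<bar>y\<bar>\<close> is a multiple of the integral of \<open>(1 - cos (y \<omega>)) / \<omega>\<^sup>2\<close>, which after convolution with \<open>u\<close> becomes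
  \<open>(1 - cos (s \<omega>) * U \<omega>) / \<omega>\<^sup>2\<close> with the cosine transform \<open>U \<ge> 0\<close> of \<open>u\<close>.
  The measure is built one coordinate at a time, from \<open>\<xi> = cos \<theta> e + sin \<theta> \<xi>'\<close> with density
  proportional to \<open>sin \<theta> ^ (d - 2)\<close>, and only its moments are computed.
  For (iii), \<open>f + abs\<close> has compact support and \<open>t = cos \<theta>\<close> removes the singularity of the weight for \<open>d = 2\<close>.\<close>

section \<open>Integrals of powers of sine and cosine\<close>

text \<open>The obstacle is the origin: \<open>norm x\<close> is not differentiable there, so
  regularity and concavity of \<open>\<Phi>\<close> cannot be read off from \<open>F\<close> by the
  chain rule. Written as an average of ridge functions, \<open>\<Phi>\<close> is differentiated and
  compared through the linear maps x -> x . \<xi>, and the norm never enters. Averages of h (x .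
  \<xi>) are all that is used of the measure, together with its bounded support. Hence the moments
  of x . \<xi> suffice: they involve x only through its length, and neither rotation invariance nor
  a surface measure has to be set up. Conditional positivity uses that coefficients with sum zero
  kill the 1 in the kernel; what remains of the quadratic form of \<open>abs_conv u\<close> is minus
  the integral of U(\<omega>) |sum_j a_j exp(i x_j \<omega>)|^2 / \<omega>^2. The constant 2
  \<open>sup_norm u\<close> comes from f'' = - 2 u and the second moment bound |x|^2 for x . \<xi>;
  the factor sqrt d enters only as a final weakening. The asymptotics need no measure on R^d: they
  concern the one-dimensional angular average alone.\<close>

definition trig_int :: "nat \<Rightarrow> nat \<Rightarrow> real" where
  "trig_int i m = integral {0..pi} (\<lambda>\<theta>. cos \<theta> ^ i * sin \<theta> ^ m)"

lemma trig_has_integral: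
  "((\<lambda>\<theta>. cos \<theta> ^ i * sin \<theta> ^ m) has_integral trig_int i m) {0..pi}"
  unfolding trig_int_def
  by (intro integrable_integral integrable_continuous_interval continuous_intros)

text \<open>Integrates the derivative of cos^(i+1) sin^(m+1); the boundary terms vanish because sine
  is zero at 0 and at pi.\<close>

lemma trig_int_parts:
  "real (m + 1) * trig_int (i + 2) m = real (i + 1) * trig_int i (m + 2)"
proof -
  let ?g = "\<lambda>\<theta>. real (m + 1) * (cos \<theta> ^ (i + 2) * sin \<theta> ^ m) - real (i + 1) * (cos \<theta> ^ i * sin \<theta> ^ (m + 2))"
  have "(?g has_integral (cos pi ^ (i + 1) * sin pi ^ (m + 1) - cos 0 ^ (i + 1) * sin 0 ^ (m + 1))) {0..pi}"
  proof (rule fundamental_theorem_of_calculus)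
    fix \<theta> :: real
    have "((\<lambda>\<theta>. cos \<theta> ^ (i + 1) * sin \<theta> ^ (m + 1)) has_real_derivative ?g \<theta>) (at \<theta> within {0..pi})"
      by (rule derivative_eq_intros refl)+ (simp add: algebra_simps)
    then show "((\<lambda>\<theta>. cos \<theta> ^ (i + 1) * sin \<theta> ^ (m + 1)) has_vector_derivative ?g \<theta>) (at \<theta> within {0..pi})"
      by (simp add: has_real_derivative_iff_has_vector_derivative)
  qed simp
  moreover have "(?g has_integral (real (m + 1) * trig_int (i + 2) m - real (i + 1) * trig_int i (m + 2))) {0..pi}"
    by (intro has_integral_diff has_integral_mult_right trig_has_integral)
  ultimately have "cos pi ^ (i + 1) * sin pi ^ (m + 1) - cos 0 ^ (i + 1) * sin 0 ^ (m + 1) =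
      real (m + 1) * trig_int (i + 2) m - real (i + 1) * trig_int i (m + 2)"
    by (rule has_integral_unique)
  then show ?thesis by simp
qed

lemma trig_int_sin_sq: "trig_int i (m + 2) = trig_int i m - trig_int (i + 2) m"
proof -
  have "((\<lambda>\<theta>. cos \<theta> ^ i * sin \<theta> ^ m - cos \<theta> ^ (i + 2) * sin \<theta> ^ m) has_integral
          trig_int i m - trig_int (i + 2) m) {0..pi}"
    by (intro has_integral_diff trig_has_integral)
  moreover have "cos \<theta> ^ i * sin \<theta> ^ m - cos \<theta> ^ (i + 2) * sin \<theta> ^ m = cos \<theta> ^ i * sin \<theta> ^ (m + 2)" for \<theta> :: real
    unfolding power_add sin_squared_eq by (simp add: algebra_simps)
  ultimately show ?thesis
    using has_integral_unique[OF trig_has_integral[of i "m + 2"]] by simp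
qed

lemma trig_int_cos_step: "real (i + m + 2) * trig_int (i + 2) m = real (i + 1) * trig_int i m"
  using trig_int_parts[of m i] unfolding trig_int_sin_sq
  by (simp add: ring_distribs del: add_2_eq_Suc' add_2_eq_Suc)

lemma trig_int_sin_step: "real (i + m + 2) * trig_int i (m + 2) = real (m + 1) * trig_int i m"
proof -
  have "trig_int i m = trig_int i (m + 2) + trig_int (i + 2) m"
    unfolding trig_int_sin_sq by simp
  then have "real (m + 1) * trig_int i m = real (m + 1) * trig_int i (m + 2) + real (i + 1) * trig_int i (m + 2)"
    unfolding trig_int_parts[symmetric] by (simp only: distrib_left)
  then show ?thesis by (simp add: ring_distribs del: add_2_eq_Suc' add_2_eq_Suc)
qed

text \<open>The recursion in the cosine exponent reduces everything to i = 1, where sin^(m+1) /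
  (m+1) is an antiderivative that vanishes at both ends.\<close>

lemma trig_int_odd: "odd i \<Longrightarrow> trig_int i m = 0"
proof (induction i rule: nat_induct2)
  case 1
  have "((\<lambda>\<theta>. cos \<theta> ^ 1 * sin \<theta> ^ m) has_integral (sin pi ^ (m + 1) / real (m + 1) - sin 0 ^ (m + 1) / real (m + 1))) {0..pi}"
  proof (rule fundamental_theorem_of_calculus)
    fix \<theta> :: real
    have "((\<lambda>\<theta>. sin \<theta> ^ (m + 1) / real (m + 1)) has_real_derivative cos \<theta> ^ 1 * sin \<theta> ^ m) (at \<theta> within {0..pi})"
      by (rule derivative_eq_intros refl | simp)+
    then show "((\<lambda>\<theta>. sin \<theta> ^ (m + 1) / real (m + 1)) has_vector_derivative cos \<theta> ^ 1 * sin \<theta> ^ m) (at \<theta> within {0..pi})"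
      by (simp add: has_real_derivative_iff_has_vector_derivative)
  qed simp
  from has_integral_unique[OF trig_has_integral this] show ?case by simp
next
  case (step n)
  then show ?case using trig_int_cos_step[of n m] by (simp del: of_nat_add)
qed simp

lemma trig_int_0_0: "trig_int 0 0 = pi"
  by (simp add: trig_int_def)

lemma trig_int_0_1: "trig_int 0 1 = 2"
proof -
  have "((\<lambda>\<theta>. sin \<theta>) has_integral (- cos pi - - cos 0)) {0..pi}"
    by (rule fundamental_theorem_of_calculus)
       (auto simp flip: has_real_derivative_iff_has_vector_derivative intro!: derivative_eq_intros)
  then show ?thesis by (simp add: trig_int_def integral_unique)
qed

text \<open>The Wallis integral; in this form it can be matched with the sphere areas in
  \<open>c_const\<close> and with the constant C_d.\<close>

lemma trig_int_Gamma:
  "trig_int 0 m = sqrt pi * Gamma ((real m + 1) / 2) / Gamma ((real m + 2) / 2)"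
proof (induction m rule: nat_induct2)
  case 0
  then show ?case by (simp add: trig_int_0_0 Gamma_one_half_real)
next
  case 1
  have "Gamma (3 / 2 :: real) = sqrt pi / 2"
    using Gamma_plus1[of "1/2::real"] nonpos_Ints_nonpos[of "1/2::real"]
    by (auto simp: Gamma_one_half_real)
  moreover have "(1 + 1) / 2 = (1::real)" "(1 + 2) / 2 = (3 / 2 :: real)" by simp_all
  ultimately show ?case unfolding of_nat_1 trig_int_0_1 by (simp only:) simp
next
  case (step m)
  have g1: "Gamma ((real m + 1) / 2 + 1) = (real m + 1) / 2 * Gamma ((real m + 1) / 2)"
    by (rule Gamma_plus1) (auto dest: nonpos_Ints_nonpos)
  have g2: "Gamma ((real m + 2) / 2 + 1) = (real m + 2) / 2 * Gamma ((real m + 2) / 2)"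
    by (rule Gamma_plus1) (auto dest: nonpos_Ints_nonpos)
  have "trig_int 0 (m + 2) = (real m + 1) / (real m + 2) * trig_int 0 m"
    using trig_int_sin_step[of 0 m] by (simp add: field_simps)
  also have "\<dots> = sqrt pi * Gamma ((real m + 1) / 2 + 1) / Gamma ((real m + 2) / 2 + 1)"
  proof -
    have "a / b * (s * x / y) = s * (a / 2 * x) / (b / 2 * y)" for a b s x y :: real
      by (simp add: divide_simps)
    then show ?thesis unfolding g1 g2 step.IH .
  qed
  also have "(real m + 1) / 2 + 1 = (real (m + 2) + 1) / 2" by simp
  also have "(real m + 2) / 2 + 1 = (real (m + 2) + 2) / 2" by simp
  finally show ?case .
qed

lemma trig_int_0_pos: "trig_int 0 m > 0"
  unfolding trig_int_Gamma by (intro divide_pos_pos mult_pos_pos Gamma_real_pos) auto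

text \<open>Iterates the two step recursions, sine exponent first. The Pochhammer form isolates the
  factor in \<open>l\<close> that cancels when the sphere measure is extended by one
  coordinate.\<close>

lemma trig_int_pochhammer:
  "trig_int (2 * j) (m + 2 * l) = trig_int 0 m * pochhammer (1/2) j * pochhammer ((real m + 1) / 2) l
     / pochhammer ((real m + 2) / 2) (j + l)"
proof (induction j)
  case 0
  show ?case
  proof (induction l)
    case (Suc l)
    have p: "pochhammer ((real m + 2) / 2) l > 0" by (intro pochhammer_pos) simp
    have "trig_int 0 (m + 2 * Suc l) = (real m + 2 * real l + 1) / (real m + 2 * real l + 2) * trig_int 0 (m + 2 * l)"
      using trig_int_sin_step[of 0 "m + 2 * l"] by (simp add: field_simps)
    then show ?case using p unfolding Suc.IH[simplified]
      by (simp add: pochhammer_Suc divide_simps) (simp add: algebra_simps)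
  qed simp
next
  case (Suc j)
  have p: "pochhammer ((real m + 2) / 2) (j + l) > 0" by (intro pochhammer_pos) simp
  have "trig_int (2 * Suc j) (m + 2 * l) = (2 * real j + 1) / (real m + 2 * real l + 2 * real j + 2) * trig_int (2 * j) (m + 2 * l)"
    using trig_int_cos_step[of "2 * j" "m + 2 * l"] by (simp add: field_simps)
  then show ?case using p unfolding Suc.IH
    by (simp add: pochhammer_Suc divide_simps) (simp add: algebra_simps)
qed

section \<open>The operator \<open>I_op\<close> as an average over the polar angle\<close>

lemma c_const_trig_int:
  assumes "d \<ge> 2" shows "c_const d = 2 / trig_int 0 (d - 2)"
proof -
  obtain m where d: "d = m + 2" using assms by (metis add.commute le_Suc_ex)
  have "pi powr ((real m + 2) / 2) = pi powr ((real m + 1) / 2) * sqrt pi"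
    by (simp add: powr_half_sqrt[symmetric] powr_add[symmetric] add_divide_distrib add.commute)
  moreover have "Gamma ((real m + 1) / 2) > 0" "Gamma ((real m + 2) / 2) > 0"
    by (auto intro!: Gamma_real_pos)
  moreover have "real (d - 2) + 1 = real m + 1" "real (d - 1) + 1 = real m + 2" "d - 2 = m"
    using assms by (auto simp: d)
  ultimately show ?thesis
    unfolding c_const_def sphere_area_def trig_int_Gamma
    by (simp only:) (simp add: field_simps)
qed

text \<open>For m = d - 2 this is the mean of h (s cos \<theta>), where \<theta> is the angle
  between a fixed axis and a uniform point of the unit sphere in R^d.\<close>

definition cos_avg :: "nat \<Rightarrow> (real \<Rightarrow> real) \<Rightarrow> real \<Rightarrow> real" where
  "cos_avg m h s = integral {0..pi} (\<lambda>\<theta>. h (s * cos \<theta>) * sin \<theta> ^ m) / trig_int 0 m"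

lemma continuous_on_compose_UNIV:
  assumes "continuous_on UNIV h" "continuous_on S g"
  shows "continuous_on S (\<lambda>x. h (g x))"
  using assms by (rule continuous_on_compose2) simp

lemma cos_avg_continuous:
  fixes h :: "real \<Rightarrow> real" and s :: real
  assumes "continuous_on UNIV h"
  shows "continuous_on S (\<lambda>\<theta>. h (s * cos \<theta>) * sin \<theta> ^ m)"
  by (intro continuous_on_mult continuous_on_compose_UNIV[OF assms] continuous_intros)

lemma cos_avg_integrable:
  fixes h :: "real \<Rightarrow> real" and s :: real
  assumes "continuous_on UNIV h"
  shows "(\<lambda>\<theta>. h (s * cos \<theta>) * sin \<theta> ^ m) integrable_on {a..b}"
  using assms by (intro integrable_continuous_interval cos_avg_continuous)

text \<open>Substituting t = cos \<theta> on (0, pi/2) turns the weight, singular at t = 1 when d =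
  2, into the continuous factor sin^(d-2).\<close>

lemma I_op_eq_cos_avg:
  assumes d: "d \<ge> 2" and h: "continuous_on UNIV h" and even: "\<And>s. h (- s) = h s"
  shows "I_op d h s = cos_avg (d - 2) h s"
proof -
  define m where "m = d - 2"
  define p where "p = (real d - 3) / 2"
  define G where "G = (\<lambda>\<theta>. h (s * cos \<theta>) * sin \<theta> ^ m)"
  define F where "F = (\<lambda>t. h (t * s) * (1 - t\<^sup>2) powr p)"
  have Gc: "continuous_on {a..b} G" for a b
    unfolding G_def using h by (rule cos_avg_continuous)
  have Gi: "G integrable_on {a..b}" for a b
    using Gc by (rule integrable_continuous_interval)
  have eq: "\<bar>- sin \<theta>\<bar> * F (cos \<theta>) = G \<theta>" if "\<theta> \<in> {0<..<pi/2}" for \<theta>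
  proof -
    have s0: "sin \<theta> > 0" using that by (intro sin_gt_zero) auto
    have "sin \<theta> * (1 - (cos \<theta>)\<^sup>2) powr p = sin \<theta> powr 1 * (sin \<theta> powr 2) powr p"
      using s0 by (simp add: sin_squared_eq[symmetric])
    also have "\<dots> = sin \<theta> powr real m"
      unfolding powr_powr powr_add[symmetric]
      using d by (intro arg_cong2[of _ _ _ _ "(powr)"]) (auto simp: p_def m_def field_simps)
    also have "\<dots> = sin \<theta> ^ m" using s0 by (simp add: powr_realpow)
    finally show ?thesis using s0 by (simp add: F_def G_def mult_ac)
  qed
  have img: "cos ` {0<..<pi/2} = {0<..<1}"
  proof safe
    fix \<theta> :: real assume "\<theta> \<in> {0<..<pi/2}"
    then show "cos \<theta> \<in> {0<..<1}"
      using cos_monotone_0_pi[of 0 \<theta>] by (auto intro: cos_gt_zero)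
  next
    fix t :: real assume t: "t \<in> {0<..<1}"
    then have "arccos t \<in> {0<..<pi/2}"
      using arccos_lt_bounded[of t] arccos_less_arccos[of 0 t] by auto
    with t show "t \<in> cos ` {0<..<pi/2}"
      by (intro image_eqI[of _ _ "arccos t"]) auto
  qed
  \<comment> \<open>The equivalence is used from left to right: integrability is clear for the
    continuous \<open>G\<close> and is thereby transferred, with the value, to the possibly
    unbounded \<open>F\<close>.\<close>
  have "(\<lambda>\<theta>. \<bar>- sin \<theta>\<bar> * F (cos \<theta>)) absolutely_integrable_on {0<..<pi/2} \<and>
        integral {0<..<pi/2} (\<lambda>\<theta>. \<bar>- sin \<theta>\<bar> * F (cos \<theta>)) = integral {0<..<pi/2} G
     \<longleftrightarrow> F absolutely_integrable_on (cos ` {0<..<pi/2}) \<and> integral (cos ` {0<..<pi/2}) F = integral {0<..<pi/2} G"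
  proof (rule has_absolute_integral_change_of_variables_1')
    show "inj_on cos {0<..<pi/2 :: real}"
      by (auto intro!: inj_onI cos_inj_pi)
  qed (auto intro: DERIV_cos has_field_derivative_at_within)
  moreover have "G absolutely_integrable_on {0<..<pi/2}"
  proof -
    have "G absolutely_integrable_on {0..pi/2}"
      using Gc absolutely_integrable_continuous_real by blast
    then show ?thesis
      by (rule set_integrable_subset) auto
  qed
  then have "(\<lambda>\<theta>. \<bar>- sin \<theta>\<bar> * F (cos \<theta>)) absolutely_integrable_on {0<..<pi/2}"
    using eq by (subst set_integrable_cong[OF refl refl, of _ _ G]) auto
  moreover have "integral {0<..<pi/2} (\<lambda>\<theta>. \<bar>- sin \<theta>\<bar> * F (cos \<theta>)) = integral {0<..<pi/2} G"
    using eq by (intro integral_cong) auto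
  ultimately have half: "integral {0..1} F = integral {0..pi/2} G"
    unfolding img by (simp add: integral_open_interval_real)
  \<comment> \<open>Evenness of \<open>h\<close> makes \<open>G\<close> symmetric about pi/2;
    doubling the half range accounts for the 2 in \<open>c_const\<close>.\<close>
  have Gsym: "G (pi - \<theta>) = G \<theta>" for \<theta>
    using even[of "s * cos \<theta>"] by (simp add: G_def)
  have "(G has_integral integral {0..pi/2} G) {0..pi/2}"
    using Gi by (rule integrable_integral)
  from has_integral_affinity[OF this[unfolded box_real[symmetric]], of "-1" pi]
  have "((\<lambda>\<theta>. G (- \<theta> + pi)) has_integral integral {0..pi/2} G) ((\<lambda>x. - x + pi) ` {0..pi/2})"
    by simp
  then have "((\<lambda>\<theta>. G (pi - \<theta>)) has_integral integral {0..pi/2} G) ((\<lambda>x. pi - x) ` {0..pi/2})"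
    by simp
  moreover have "(\<lambda>x. pi - x) ` {0..pi/2} = {pi/2..pi}" by simp
  ultimately have "integral {pi/2..pi} G = integral {0..pi/2} G"
    by (simp add: Gsym integral_unique)
  moreover have "integral {0..pi/2} G + integral {pi/2..pi} G = integral {0..pi} G"
    by (rule Henstock_Kurzweil_Integration.integral_combine) (auto intro: Gi)
  ultimately have "integral {0..pi} G = 2 * integral {0..1} F" using half by simp
  then show ?thesis
    unfolding I_op_def cos_avg_def c_const_trig_int[OF d] F_def G_def p_def m_def
    by simp
qed

section \<open>A measure with the projections of the uniform measure on the sphere\<close>

lemma sum_even_indices:
  fixes f :: "nat \<Rightarrow> real"
  assumes "\<And>k. odd k \<Longrightarrow> f k = 0"
  shows "(\<Sum>k\<le>2 * N. f k) = (\<Sum>j\<le>N. f (2 * j))"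
  by (induction N) (use assms in auto)

text \<open>Follows from (1/2)_n = (2n)! / (4^n n!). It turns the even part of an expanded moment
  into an ordinary binomial sum.\<close>

lemma binomial_pochhammer_half:
  assumes "j \<le> k"
  shows "real (2 * k choose (2 * j)) * pochhammer (1/2) j * pochhammer (1/2) (k - j) =
    real (k choose j) * pochhammer (1/2) k"
proof -
  have f: "pochhammer (1/2) n = fact (2 * n) / (2 ^ (2 * n) * fact n :: real)" for n
    using fact_double[of n, where 'a = real] by (simp add: field_simps)
  have *: "(2::real) ^ (2 * k) = 2 ^ (2 * j) * 2 ^ (2 * (k - j))"
    using assms by (simp add: power_add[symmetric])
  have "real (2 * k choose (2 * j)) = fact (2 * k) / (fact (2 * j) * fact (2 * (k - j)))"
    using assms by (subst binomial_fact) (auto simp: diff_mult_distrib2)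
  moreover have "real (k choose j) = fact k / (fact j * fact (k - j))"
    using assms by (rule binomial_fact)
  ultimately show ?thesis
    unfolding f * by (simp add: field_simps)
qed

text \<open>The law of the polar angle of a uniform point on the unit sphere in dimension m +
  2.\<close>

definition angle_measure :: "nat \<Rightarrow> real measure" where
  "angle_measure m = density lborel (\<lambda>\<theta>. ennreal (indicator {0..pi} \<theta> * sin \<theta> ^ m / trig_int 0 m))"

lemma sets_angle_measure [simp, measurable_cong]: "sets (angle_measure m) = sets borel"
  by (simp add: angle_measure_def)

lemma angle_density_nonneg: "0 \<le> indicator {0..pi} \<theta> * sin \<theta> ^ m / trig_int 0 m"
  using trig_int_0_pos[of m]
  by (auto simp: indicator_def intro!: divide_nonneg_pos zero_le_power sin_ge_zero)

lemma angle_measure_continuous: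
  assumes g: "continuous_on UNIV (g :: real \<Rightarrow> real)"
  shows "integrable (angle_measure m) g"
    and "integral\<^sup>L (angle_measure m) g = integral {0..pi} (\<lambda>\<theta>. g \<theta> * sin \<theta> ^ m) / trig_int 0 m"
proof -
  have gm: "g \<in> borel_measurable borel"
    using g by (rule borel_measurable_continuous_onI)
  have c: "continuous_on {0..pi} (\<lambda>\<theta>. g \<theta> * sin \<theta> ^ m)"
    by (intro continuous_intros continuous_on_subset[OF g]) auto
  then have si: "set_integrable lborel {0..pi} (\<lambda>\<theta>. g \<theta> * sin \<theta> ^ m)"
    unfolding set_integrable_def by (intro borel_integrable_compact) auto
  have eq: "(indicator {0..pi} \<theta> * sin \<theta> ^ m / trig_int 0 m) *\<^sub>R g \<theta> =
      indicator {0..pi} \<theta> *\<^sub>R (g \<theta> * sin \<theta> ^ m) / trig_int 0 m" for \<theta> :: real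
    by simp
  show "integrable (angle_measure m) g"
    unfolding angle_measure_def using si
    by (subst integrable_density) (auto simp: gm angle_density_nonneg eq set_integrable_def simp del: real_scaleR_def)
  have "integral\<^sup>L (angle_measure m) g = (LBINT \<theta>:{0..pi}. g \<theta> * sin \<theta> ^ m) / trig_int 0 m"
    unfolding angle_measure_def
    by (subst integral_density) (auto simp: gm angle_density_nonneg eq set_lebesgue_integral_def simp del: real_scaleR_def)
  then show "integral\<^sup>L (angle_measure m) g = integral {0..pi} (\<lambda>\<theta>. g \<theta> * sin \<theta> ^ m) / trig_int 0 m"
    using si by (simp add: set_borel_integral_eq_integral)
qed

lemma finite_angle_measure: "finite_measure (angle_measure m)"
proof
  have "integrable (angle_measure m) (\<lambda>_. 1 :: real)"
    by (rule angle_measure_continuous) simp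
  then show "emeasure (angle_measure m) (space (angle_measure m)) \<noteq> \<infinity>"
    by (simp add: integrable_iff_bounded)
qed

text \<open>The n-th moment of one coordinate of a uniform point on the unit sphere in R^c. For c =
  1 the two Pochhammer symbols agree and the even moments are 1.\<close>

definition half_moment :: "nat \<Rightarrow> nat \<Rightarrow> real" where
  "half_moment c n = (if even n then pochhammer (1/2) (n div 2) / pochhammer (real c / 2) (n div 2) else 0)"

text \<open>\<open>x \<bullet> \<xi>\<close> has the moments it would have for \<open>\<xi>\<close> uniform on the unit sphere of the
  coordinate subspace \<open>I\<close>, and the moments determine this bounded law.\<close>

definition sphere_like :: "'d::finite set \<Rightarrow> (real^'d) measure \<Rightarrow> bool" where
  "sphere_like I M \<longleftrightarrow> finite_measure M \<and> sets M = sets borel \<and> (\<exists>B. AE \<xi> in M. norm \<xi> \<le> B) \<and>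
     (\<forall>x n. (\<integral>\<xi>. (x \<bullet> \<xi>) ^ n \<partial>M) = half_moment (card I) n * sqrt (\<Sum>i\<in>I. (x $ i)\<^sup>2) ^ n)"

lemma integrable_bounded_support:
  fixes g :: "'a::euclidean_space \<Rightarrow> real"
  assumes "finite_measure M" "sets M = sets borel" and B: "AE \<xi> in M. norm \<xi> \<le> B"
    and g: "continuous_on UNIV g"
  shows "integrable M g"
proof -
  interpret finite_measure M by fact
  have "compact (g ` cball 0 B)"
    by (intro compact_continuous_image continuous_on_subset[OF g]) auto
  then obtain C where C: "\<And>\<xi>. \<xi> \<in> cball 0 B \<Longrightarrow> norm (g \<xi>) \<le> C"
    by (meson compact_imp_bounded bounded_iff imageI)
  have "AE \<xi> in M. norm (g \<xi>) \<le> C"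
    using B by eventually_elim (rule C, simp)
  moreover have "g \<in> borel_measurable M"
    using borel_measurable_continuous_onI[OF g] assms(2) by (simp cong: measurable_cong_sets)
  ultimately show ?thesis by (rule integrable_const_bound)
qed

text \<open>The zero-dimensional sphere: mass 1/2 at each of e_i and - e_i, so odd moments
  cancel.\<close>

lemma sphere_like_singleton:
  "\<exists>M. sphere_like {i :: 'd::finite} M"
proof -
  define N where "N = density (count_space (UNIV :: bool set)) (\<lambda>_. ennreal (1/2))"
  define X :: "bool \<Rightarrow> real^'d" where "X = (\<lambda>b. if b then axis i 1 else - axis i 1)"
  define M where "M = distr N borel X"
  have X: "X \<in> measurable N borel" by (simp add: N_def)
  interpret N: finite_measure N
    by standard (simp add: N_def emeasure_density nn_integral_count_space_finite ennreal_mult_eq_top_iff UNIV_bool)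
  have "finite_measure M" unfolding M_def using X by (rule N.finite_measure_distr)
  moreover have "AE \<xi> in M. norm \<xi> \<le> 1"
    unfolding M_def using X by (subst AE_distr_iff) (auto simp: X_def norm_axis_1)
  moreover have "(\<integral>\<xi>. (x \<bullet> \<xi>) ^ n \<partial>M) = half_moment (card {i}) n * sqrt (\<Sum>i\<in>{i}. (x $ i)\<^sup>2) ^ n" for x n
  proof -
    have "(\<integral>\<xi>. (x \<bullet> \<xi>) ^ n \<partial>M) = (\<integral>b. (x \<bullet> X b) ^ n \<partial>N)"
      unfolding M_def using X by (subst integral_distr) auto
    also have "\<dots> = (\<Sum>b\<in>UNIV. 1/2 * (x \<bullet> X b) ^ n)"
      unfolding N_def by (subst integral_density) (auto simp: lebesgue_integral_count_space_finite sum_distrib_right)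
    also have "\<dots> = ((x $ i) ^ n + (- (x $ i)) ^ n) / 2"
      by (simp add: UNIV_bool X_def inner_axis)
    also have "\<dots> = half_moment 1 n * \<bar>x $ i\<bar> ^ n"
    proof (cases "even n")
      case True
      moreover have "pochhammer (1/2 :: real) (n div 2) > 0" by (rule pochhammer_pos) simp
      ultimately show ?thesis by (simp add: half_moment_def power_even_abs)
    qed (simp add: half_moment_def)
    finally show ?thesis by simp
  qed
  ultimately have "sphere_like {i} M" unfolding sphere_like_def by (auto simp: M_def)
  then show ?thesis ..
qed

text \<open>Fubini and the binomial expansion of (x_i cos \<theta> + sin \<theta> (x . \<xi>))^n
  reduce a moment of the new measure to products of known moments of \<theta> and of \<xi>.\<close>

lemma sphere_like_insert:
  fixes I :: "'d::finite set"
  assumes M: "sphere_like I M" and I: "I \<noteq> {}" "i \<notin> I"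
  shows "\<exists>M. sphere_like (insert i I) M"
proof -
  \<comment> \<open>The polar-coordinate exponent: the enlarged sphere lives in dimension card I +
    1, and the exponent is that dimension minus 2.\<close>
  define m where "m = card I - 1"
  have "card I > 0" using I by (simp add: card_gt_0_iff)
  then have cI: "card I = m + 1" by (simp add: m_def)
  define T where "T = angle_measure m"
  define X where "X = (\<lambda>(\<theta>, \<xi>). cos \<theta> *\<^sub>R axis i 1 + sin \<theta> *\<^sub>R (\<xi> :: real^'d))"
  have setsM [measurable_cong]: "sets M = sets borel" using M by (simp add: sphere_like_def)
  have setsT [measurable_cong]: "sets T = sets borel" by (simp add: T_def)
  interpret M: finite_measure M using M by (simp add: sphere_like_def)
  interpret T: finite_measure T unfolding T_def by (rule finite_angle_measure)
  interpret P: pair_sigma_finite T M ..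
  interpret TM: finite_measure "T \<Otimes>\<^sub>M M"
    by (rule finite_measure_pair_measure) unfold_locales
  obtain B where B: "AE \<xi> in M. norm \<xi> \<le> B" using M by (auto simp: sphere_like_def)
  have mom: "(\<integral>\<xi>. (x \<bullet> \<xi>) ^ n \<partial>M) = half_moment (card I) n * sqrt (\<Sum>i\<in>I. (x $ i)\<^sup>2) ^ n" for x n
    using M by (simp add: sphere_like_def)
  have X [measurable]: "X \<in> borel_measurable (T \<Otimes>\<^sub>M M)"
    unfolding X_def by measurable
  define M' where "M' = distr (T \<Otimes>\<^sub>M M) borel X"
  have fin: "finite_measure M'"
    unfolding M'_def using X by (rule TM.finite_measure_distr)
  have "AE p in T \<Otimes>\<^sub>M M. norm (X p) \<le> 1 + B"
  proof (rule P.AE_pair_measure)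
    show "{p \<in> space (T \<Otimes>\<^sub>M M). norm (X p) \<le> 1 + B} \<in> sets (T \<Otimes>\<^sub>M M)" by measurable
    show "AE \<theta> in T. AE \<xi> in M. norm (X (\<theta>, \<xi>)) \<le> 1 + B"
    proof (rule AE_I2)
      fix \<theta>
      show "AE \<xi> in M. norm (X (\<theta>, \<xi>)) \<le> 1 + B"
        using B
      proof eventually_elim
        case (elim \<xi>)
        have "norm (X (\<theta>, \<xi>)) \<le> \<bar>cos \<theta>\<bar> + \<bar>sin \<theta>\<bar> * norm \<xi>"
          unfolding X_def by (auto intro!: order_trans[OF norm_triangle_ineq] simp: norm_axis_1)
        also have "\<dots> \<le> 1 + 1 * B"
          using elim by (intro add_mono mult_mono) auto
        finally show ?case by simp
      qed
    qed
  qed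
  then have bd: "AE \<xi> in M'. norm \<xi> \<le> 1 + B"
    unfolding M'_def using X by (subst AE_distr_iff) auto
  have "(\<integral>\<xi>. (x \<bullet> \<xi>) ^ n \<partial>M') = half_moment (card (insert i I)) n * sqrt (\<Sum>i\<in>insert i I. (x $ i)\<^sup>2) ^ n" for x n
  proof -
    define r where "r = sqrt (\<Sum>i\<in>I. (x $ i)\<^sup>2)"
    define E where "E = half_moment (card I)"
    have int': "integrable M' (\<lambda>\<xi>. (x \<bullet> \<xi>) ^ n)"
      by (rule integrable_bounded_support[OF fin _ bd]) (auto simp: M'_def intro!: continuous_intros)
    then have int: "integrable (T \<Otimes>\<^sub>M M) (\<lambda>p. (x \<bullet> X p) ^ n)"
      unfolding M'_def using X by (subst (asm) integrable_distr_eq) auto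
    have "(\<integral>\<xi>. (x \<bullet> \<xi>) ^ n \<partial>M') = (\<integral>p. (x \<bullet> X p) ^ n \<partial>(T \<Otimes>\<^sub>M M))"
      unfolding M'_def using X by (subst integral_distr) auto
    also have "\<dots> = (\<integral>\<theta>. (\<integral>\<xi>. (x \<bullet> X (\<theta>, \<xi>)) ^ n \<partial>M) \<partial>T)"
      using int by (rule P.integral_fst'[symmetric])
    also have "\<dots> = (\<integral>\<theta>. (\<Sum>k\<le>n. (real (n choose k) * (x $ i) ^ k * (E (n - k) * r ^ (n - k))) * (cos \<theta> ^ k * sin \<theta> ^ (n - k))) \<partial>T)"
    proof (rule Bochner_Integration.integral_cong[OF refl])
      fix \<theta>
      have "(x \<bullet> X (\<theta>, \<xi>)) ^ n = (\<Sum>k\<le>n. (real (n choose k) * (x $ i) ^ k * cos \<theta> ^ k * sin \<theta> ^ (n - k)) * (x \<bullet> \<xi>) ^ (n - k))" for \<xi>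
      proof -
        have "x \<bullet> X (\<theta>, \<xi>) = x $ i * cos \<theta> + sin \<theta> * (x \<bullet> \<xi>)"
          by (simp add: X_def inner_add_right inner_axis)
        then show ?thesis
          by (simp only: binomial_ring) (auto simp: power_mult_distrib intro!: sum.cong)
      qed
      moreover have "integrable M (\<lambda>\<xi>. (x \<bullet> \<xi>) ^ k)" for k
        by (rule integrable_bounded_support[OF M.finite_measure_axioms setsM B]) (intro continuous_intros)
      ultimately show "(\<integral>\<xi>. (x \<bullet> X (\<theta>, \<xi>)) ^ n \<partial>M) = (\<Sum>k\<le>n. (real (n choose k) * (x $ i) ^ k * (E (n - k) * r ^ (n - k))) * (cos \<theta> ^ k * sin \<theta> ^ (n - k)))"
        by (simp add: mom E_def r_def mult_ac)
    qed
    also have "\<dots> = (\<Sum>k\<le>n. (real (n choose k) * (x $ i) ^ k * (E (n - k) * r ^ (n - k))) * (trig_int k (m + (n - k)) / trig_int 0 m))"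
    proof -
      have c: "continuous_on UNIV (\<lambda>\<theta>::real. cos \<theta> ^ k * sin \<theta> ^ (n - k))" for k
        by (intro continuous_intros)
      have "integral\<^sup>L T (\<lambda>\<theta>. cos \<theta> ^ k * sin \<theta> ^ (n - k)) = trig_int k (m + (n - k)) / trig_int 0 m" for k
        unfolding T_def angle_measure_continuous(2)[OF c] trig_int_def by (simp add: power_add mult_ac)
      then show ?thesis
        using angle_measure_continuous(1)[OF c] by (simp add: T_def)
    qed
    also have "\<dots> = half_moment (m + 2) n * sqrt ((x $ i)\<^sup>2 + r\<^sup>2) ^ n" (is "(\<Sum>k\<le>n. ?f k) = _")
    proof (cases "even n")
      case False
      \<comment> \<open>For odd \<open>n\<close>, either k is odd and the angular integral vanishes,
        or n - k is odd and the moment of the smaller sphere does.\<close>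
      then have "?f k = 0" if "k \<le> n" for k
        using that by (cases "odd k") (auto simp: trig_int_odd E_def half_moment_def)
      then have "(\<Sum>k\<le>n. ?f k) = 0" by (intro sum.neutral) auto
      then show ?thesis using False by (simp add: half_moment_def)
    next
      case True
      then obtain N where n: "n = 2 * N" by auto
      have pN: "pochhammer ((real m + 2) / 2) N > 0" by (rule pochhammer_pos) simp
      have p1: "pochhammer ((real m + 1) / 2) l > 0" for l by (rule pochhammer_pos) simp
      have "(\<Sum>k\<le>n. ?f k) = (\<Sum>j\<le>N. ?f (2 * j))"
        unfolding n by (rule sum_even_indices) (simp add: trig_int_odd)
      also have "\<dots> = (\<Sum>j\<le>N. pochhammer (1/2) N / pochhammer ((real m + 2) / 2) N *
          (real (N choose j) * ((x $ i)\<^sup>2) ^ j * (r\<^sup>2) ^ (N - j)))"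
      proof (rule sum.cong[OF refl])
        fix j assume "j \<in> {..N}"
        then have j: "j \<le> N" by simp
        then have nj: "n - 2 * j = 2 * (N - j)" by (simp add: n diff_mult_distrib2)
        have e: "E (2 * (N - j)) = pochhammer (1/2) (N - j) / pochhammer ((real m + 1) / 2) (N - j)"
          by (simp add: E_def half_moment_def cI add.commute)
        \<comment> \<open>The symbol ((m+1)/2)_(N-j) here cancels the denominator in
          \<open>e\<close>; only halves and the common ((m+2)/2)_N survive.\<close>
        have t: "trig_int (2 * j) (m + 2 * (N - j)) / trig_int 0 m =
            pochhammer (1/2) j * pochhammer ((real m + 1) / 2) (N - j) / pochhammer ((real m + 2) / 2) N"
          unfolding trig_int_pochhammer using trig_int_0_pos[of m] j by simp
        have "?f (2 * j) = (real (2 * N choose (2 * j)) * pochhammer (1/2) j * pochhammer (1/2) (N - j)) *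
            ((x $ i)\<^sup>2) ^ j * (r\<^sup>2) ^ (N - j) / pochhammer ((real m + 2) / 2) N"
          unfolding nj e t using p1[of "N - j"] by (simp add: n power_mult)
        also have "\<dots> = (real (N choose j) * pochhammer (1/2) N) *
            ((x $ i)\<^sup>2) ^ j * (r\<^sup>2) ^ (N - j) / pochhammer ((real m + 2) / 2) N"
          unfolding binomial_pochhammer_half[OF j] ..
        finally show "?f (2 * j) = pochhammer (1/2) N / pochhammer ((real m + 2) / 2) N *
          (real (N choose j) * ((x $ i)\<^sup>2) ^ j * (r\<^sup>2) ^ (N - j))" by simp
      qed
      also have "\<dots> = pochhammer (1/2) N / pochhammer ((real m + 2) / 2) N * ((x $ i)\<^sup>2 + r\<^sup>2) ^ N"
        by (simp add: binomial_ring sum_distrib_left)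
      also have "((x $ i)\<^sup>2 + r\<^sup>2) ^ N = sqrt ((x $ i)\<^sup>2 + r\<^sup>2) ^ n"
        by (simp add: n power_mult)
      finally show ?thesis by (simp add: half_moment_def n add.commute)
    qed
    also have "m + 2 = card (insert i I)" using I by (simp add: cI)
    also have "(x $ i)\<^sup>2 + r\<^sup>2 = (\<Sum>i\<in>insert i I. (x $ i)\<^sup>2)"
      using I by (simp add: r_def sum_nonneg)
    finally show ?thesis .
  qed
  with fin bd have "sphere_like (insert i I) M'"
    unfolding sphere_like_def by (auto simp: M'_def)
  then show ?thesis ..
qed

lemma sphere_like_exists:
  assumes "I \<noteq> {}" shows "\<exists>M. sphere_like (I :: 'd::finite set) M"
  using finite[of I] assms
proof (induction I rule: finite_ne_induct)
  case (singleton x)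
  show ?case by (rule sphere_like_singleton)
next
  case (insert x F)
  then show ?case using sphere_like_insert by blast
qed

text \<open>The moments determine the law of \<open>x \<bullet> \<xi>\<close> by Weierstrass approximation.\<close>

lemma sphere_measure_exists:
  assumes "CARD('d::finite) \<ge> 2"
  obtains M :: "(real^'d) measure" and B where "finite_measure M" "sets M = sets borel"
    "AE \<xi> in M. norm \<xi> \<le> B" "B > 0"
    "\<And>h x. continuous_on UNIV h \<Longrightarrow> (\<integral>\<xi>. h (x \<bullet> \<xi>) \<partial>M) = cos_avg (CARD('d) - 2) h (norm x)"
proof -
  obtain M :: "(real^'d) measure" where M: "sphere_like UNIV M"
    using sphere_like_exists[of UNIV] by auto
  define m where "m = CARD('d) - 2"
  define T where "T = angle_measure m"
  have cd: "CARD('d) = m + 2" using assms by (simp add: m_def)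
  have setsM: "sets M = sets borel" using M by (simp add: sphere_like_def)
  interpret M: finite_measure M using M by (simp add: sphere_like_def)
  interpret T: finite_measure T unfolding T_def by (rule finite_angle_measure)
  obtain B0 where B0: "AE \<xi> in M. norm \<xi> \<le> B0" using M by (auto simp: sphere_like_def)
  \<comment> \<open>With B at least 1, the single interval of radius \<open>norm x * B\<close>
    contains both x . \<xi> and \<open>norm x * cos \<theta>\<close>.\<close>
  define B where "B = max B0 1"
  have B: "AE \<xi> in M. norm \<xi> \<le> B" using B0 by eventually_elim (simp add: B_def)
  have Bpos: "B \<ge> 1" by (simp add: B_def)
  have mom: "(\<integral>\<xi>. (x \<bullet> \<xi>) ^ n \<partial>M) = (\<integral>\<theta>. (norm x * cos \<theta>) ^ n \<partial>T)" for x n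
  proof -
    have nx: "sqrt (\<Sum>i\<in>UNIV. (x $ i)\<^sup>2) = norm x"
      by (simp add: norm_vec_def L2_set_def)
    have "half_moment CARD('d) n = trig_int n m / trig_int 0 m"
    proof (cases "even n")
      case True
      then obtain N where n: "n = 2 * N" by auto
      show ?thesis
        using trig_int_pochhammer[of N m 0] trig_int_0_pos[of m]
        by (simp add: n half_moment_def cd add.commute)
    qed (simp add: half_moment_def trig_int_odd)
    moreover have c: "continuous_on UNIV (\<lambda>\<theta>. (norm x * cos \<theta>) ^ n)"
      by (intro continuous_intros)
    have "(\<integral>\<theta>. (norm x * cos \<theta>) ^ n \<partial>T) = norm x ^ n * trig_int n m / trig_int 0 m"
      unfolding T_def angle_measure_continuous(2)[OF c] trig_int_def
      by (simp add: power_mult_distrib mult.assoc)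
    ultimately show ?thesis
      using M by (simp add: sphere_like_def nx)
  qed
  have intM: "integrable M (\<lambda>\<xi>. h (x \<bullet> \<xi>))" if "continuous_on UNIV h" for h :: "real \<Rightarrow> real" and x
    by (rule integrable_bounded_support[OF M.finite_measure_axioms setsM B])
       (intro continuous_on_compose_UNIV[OF that] continuous_intros)
  have intT: "integrable T (\<lambda>\<theta>. h (norm x * cos \<theta>))" if "continuous_on UNIV h" for h :: "real \<Rightarrow> real" and x :: "real^'d"
    unfolding T_def
    by (intro angle_measure_continuous(1) continuous_on_compose_UNIV[OF that] continuous_intros)
  have main: "(\<integral>\<xi>. h (x \<bullet> \<xi>) \<partial>M) = (\<integral>\<theta>. h (norm x * cos \<theta>) \<partial>T)" if h: "continuous_on UNIV h" for h :: "real \<Rightarrow> real" and x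
  proof (rule ccontr)
    define D where "D = \<bar>(\<integral>\<xi>. h (x \<bullet> \<xi>) \<partial>M) - (\<integral>\<theta>. h (norm x * cos \<theta>) \<partial>T)\<bar>"
    \<comment> \<open>The extra 1 makes \<open>W\<close> positive and brings the two approximation
      errors to at most D (W - 1) / W, strictly below \<open>D\<close>.\<close>
    define W where "W = measure M (space M) + measure T (space T) + 1"
    define R where "R = norm x * B"
    assume "\<not> ?thesis"
    then have D: "D > 0" by (simp add: D_def)
    have W: "W > 0" by (simp add: W_def add_nonneg_pos)
    obtain g where g: "real_polynomial_function g" "\<And>t. t \<in> {-R..R} \<Longrightarrow> \<bar>h t - g t\<bar> < D / W"
      using Stone_Weierstrass_real_polynomial_function[of "{-R..R}" h "D / W"] D W
        continuous_on_subset[OF h] by (metis compact_Icc divide_pos_pos subset_UNIV)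
    obtain a n where ga: "g = (\<lambda>t. \<Sum>k\<le>n. a k * t ^ k)"
      using g(1) unfolding real_polynomial_function_iff_sum by auto
    have gc: "continuous_on UNIV g" unfolding ga by (intro continuous_intros)
    have pc: "continuous_on UNIV (\<lambda>t::real. t ^ k)" for k by (intro continuous_intros)
    have eq: "(\<integral>\<xi>. g (x \<bullet> \<xi>) \<partial>M) = (\<integral>\<theta>. g (norm x * cos \<theta>) \<partial>T)"
      unfolding ga using intM[OF pc] intT[OF pc] by (simp add: mom)
    have 1: "\<bar>(\<integral>\<xi>. h (x \<bullet> \<xi>) \<partial>M) - (\<integral>\<xi>. g (x \<bullet> \<xi>) \<partial>M)\<bar> \<le> D / W * measure M (space M)"
    proof -
      have "\<bar>\<integral>\<xi>. h (x \<bullet> \<xi>) - g (x \<bullet> \<xi>) \<partial>M\<bar> \<le> (\<integral>\<xi>. D / W \<partial>M)"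
      proof (rule order_trans[OF integral_abs_bound], rule integral_mono_AE)
        show "AE \<xi> in M. \<bar>h (x \<bullet> \<xi>) - g (x \<bullet> \<xi>)\<bar> \<le> D / W"
          using B
        proof eventually_elim
          case (elim \<xi>)
          have "\<bar>x \<bullet> \<xi>\<bar> \<le> norm x * norm \<xi>" by (rule Cauchy_Schwarz_ineq2)
          also have "\<dots> \<le> R" unfolding R_def using elim by (intro mult_left_mono) auto
          finally have "x \<bullet> \<xi> \<in> {-R..R}" by auto
          from g(2)[OF this] show ?case by simp
        qed
      qed (auto intro!: intM h gc continuous_on_diff Bochner_Integration.integrable_diff integrable_abs)
      then show ?thesis by (simp add: Bochner_Integration.integral_diff intM h gc mult.commute)
    qed
    have 2: "\<bar>(\<integral>\<theta>. h (norm x * cos \<theta>) \<partial>T) - (\<integral>\<theta>. g (norm x * cos \<theta>) \<partial>T)\<bar> \<le> D / W * measure T (space T)"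
    proof -
      have "\<bar>\<integral>\<theta>. h (norm x * cos \<theta>) - g (norm x * cos \<theta>) \<partial>T\<bar> \<le> (\<integral>\<theta>. D / W \<partial>T)"
      proof (rule order_trans[OF integral_abs_bound], rule integral_mono)
        fix \<theta>
        have "\<bar>norm x * cos \<theta>\<bar> \<le> norm x * B"
          unfolding abs_mult using Bpos by (intro mult_mono order_trans[OF abs_cos_le_one]) auto
        then show "\<bar>h (norm x * cos \<theta>) - g (norm x * cos \<theta>)\<bar> \<le> D / W"
          using g(2)[of "norm x * cos \<theta>"] by (auto simp: R_def abs_le_iff)
      qed (auto intro!: intT h gc continuous_on_diff Bochner_Integration.integrable_diff integrable_abs)
      then show ?thesis by (simp add: Bochner_Integration.integral_diff intT h gc mult.commute)
    qed
    have "D \<le> D / W * measure M (space M) + D / W * measure T (space T)"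
      unfolding D_def[symmetric] using 1 2 eq unfolding D_def by linarith
    also have "\<dots> = D / W * (W - 1)" unfolding distrib_left[symmetric] by (simp add: W_def)
    also have "\<dots> < D" using D W by (simp add: field_simps)
    finally show False by simp
  qed
  have "(\<integral>\<xi>. h (x \<bullet> \<xi>) \<partial>M) = cos_avg m h (norm x)" if h: "continuous_on UNIV h" for h x
  proof -
    have c: "continuous_on UNIV (\<lambda>\<theta>. h (norm x * cos \<theta>))"
      by (intro continuous_on_compose_UNIV[OF h] continuous_intros)
    show ?thesis
      unfolding main[OF h] T_def angle_measure_continuous(2)[OF c] cos_avg_def ..
  qed
  with that[of M B] show thesis
    using M.finite_measure_axioms setsM B Bpos by (auto simp: m_def)
qed

section \<open>Averages of ridge functions\<close>

lemma Ck_imp_continuous: "Ck k h \<Longrightarrow> continuous_on UNIV h"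
  by (cases k) (auto intro!: continuous_at_imp_continuous_on differentiable_imp_continuous_within)

lemma Ck_cmult: "Ck k h \<Longrightarrow> Ck k (\<lambda>x. c * h x)"
proof (induction k arbitrary: h)
  case 0
  then show ?case by (simp add: continuous_intros)
next
  case (Suc k)
  then have d: "h differentiable (at x)" for x by simp
  then have "((\<lambda>x. c * h x) has_derivative (\<lambda>v. c * frechet_derivative h (at x) v)) (at x)" for x
    by (intro has_derivative_mult_right) (simp add: frechet_derivative_works[symmetric])
  then have "frechet_derivative (\<lambda>x. c * h x) (at x) = (\<lambda>v. c * frechet_derivative h (at x) v)" for x
    by (metis frechet_derivative_at)
  with Suc d show ?case by (simp add: differentiable_cmult_left_iff)
qed

lemma Ck_Suc_real:
  fixes h :: "real \<Rightarrow> real"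
  assumes "\<And>s. (h has_real_derivative h' s) (at s)"
  shows "Ck (Suc k) h \<longleftrightarrow> Ck k h'"
proof -
  have "frechet_derivative h (at s) = (\<lambda>v. h' s * v)" for s
    using assms[of s] by (metis frechet_derivative_at has_field_derivative_def)
  moreover have "h differentiable (at s)" for s
    using assms[of s] by (auto simp: has_field_derivative_def differentiable_def)
  ultimately show ?thesis by simp
qed

lemma linearization_bound:
  fixes h :: "real \<Rightarrow> real"
  assumes h: "\<And>s. (h has_real_derivative h' s) (at s)"
    and e: "\<And>z. z \<in> closed_segment a b \<Longrightarrow> \<bar>h' z - h' a\<bar> \<le> e"
  shows "\<bar>h b - h a - h' a * (b - a)\<bar> \<le> e * \<bar>b - a\<bar>"
proof -
  have "\<exists>z\<in>closed_segment a b. h b - h a = (b - a) * h' z"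
  proof (cases a b rule: linorder_cases)
    case less
    from MVT2[OF less h] show ?thesis by (force simp: closed_segment_eq_real_ivl)
  next
    case greater
    from MVT2[OF greater h] obtain z where "b < z" "z < a" "h a - h b = (a - b) * h' z" by auto
    then show ?thesis by (intro bexI[of _ z]) (auto simp: closed_segment_eq_real_ivl algebra_simps)
  qed auto
  then obtain z where z: "z \<in> closed_segment a b" "h b - h a = (b - a) * h' z" by auto
  then have "\<bar>h b - h a - h' a * (b - a)\<bar> = \<bar>h' z - h' a\<bar> * \<bar>b - a\<bar>"
    by (simp add: abs_mult[symmetric] algebra_simps)
  then show ?thesis using e[OF z(1)] by (simp add: mult_right_mono)
qed

section \<open>Differentiation of ridge averages under the integral sign\<close>

locale bounded_borel_measure = finite_measure M for M :: "'a::euclidean_space measure" +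
  fixes B :: real
  assumes sets_M [measurable_cong]: "sets M = sets borel"
    and AE_bound: "AE \<xi> in M. norm \<xi> \<le> B" and B_pos: "B > 0"
begin

lemma integrable_continuous: "continuous_on UNIV g \<Longrightarrow> integrable M (g :: 'a \<Rightarrow> real)"
  using integrable_bounded_support[OF finite_measure_axioms sets_M AE_bound] .

lemma integrable_ridge:
  assumes "continuous_on UNIV h" "continuous_on UNIV p"
  shows "integrable M (\<lambda>\<xi>. h (x \<bullet> \<xi>) * p \<xi> :: real)"
  by (intro integrable_continuous continuous_intros continuous_on_compose_UNIV[OF assms(1)] assms(2))

lemma inner_bound: "norm \<xi> \<le> B \<Longrightarrow> \<bar>x \<bullet> \<xi>\<bar> \<le> B * norm x"
  by (rule order_trans[OF Cauchy_Schwarz_ineq2]) (simp add: mult.commute mult_right_mono)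

lemma continuous_on_bound:
  fixes p :: "'a \<Rightarrow> real"
  assumes "continuous_on UNIV p"
  obtains C where "C > 0" "\<And>\<xi>. norm \<xi> \<le> B \<Longrightarrow> \<bar>p \<xi>\<bar> \<le> C"
proof -
  have "bounded (p ` cball 0 B)"
    by (intro compact_imp_bounded compact_continuous_image continuous_on_subset[OF assms]) auto
  then obtain C where "C > 0" "\<forall>y\<in>p ` cball 0 B. norm y \<le> C"
    unfolding bounded_pos by auto
  then show thesis by (intro that[of C]) auto
qed

text \<open>On the bounded support the difference quotients converge uniformly: the mean value
  theorem bounds the remainder by the oscillation of \<open>h'\<close>, which is uniformly
  continuous on a compact interval.\<close>

lemma has_derivative_integral_ridge:
  fixes h :: "real \<Rightarrow> real" and p :: "'a \<Rightarrow> real"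
  assumes h: "\<And>s. (h has_real_derivative h' s) (at s)"
    and h': "continuous_on UNIV h'" and p: "continuous_on UNIV p"
  shows "((\<lambda>x. \<integral>\<xi>. h (x \<bullet> \<xi>) * p \<xi> \<partial>M) has_derivative (\<lambda>v. \<integral>\<xi>. h' (x \<bullet> \<xi>) * ((v \<bullet> \<xi>) * p \<xi>) \<partial>M)) (at x)"
  unfolding has_derivative_at_alt
proof (intro conjI allI impI)
  have hc: "continuous_on UNIV h"
    using h by (meson DERIV_isCont continuous_at_imp_continuous_on)
  have pv: "continuous_on UNIV (\<lambda>\<xi>. (v \<bullet> \<xi>) * p \<xi>)" for v
    by (intro continuous_intros p)
  note int = integrable_ridge[OF h' pv]
  let ?D = "\<lambda>v. \<integral>\<xi>. h' (x \<bullet> \<xi>) * ((v \<bullet> \<xi>) * p \<xi>) \<partial>M"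
  have "linear ?D"
  proof (rule linearI)
    fix v w
    have "?D (v + w) = (\<integral>\<xi>. h' (x \<bullet> \<xi>) * ((v \<bullet> \<xi>) * p \<xi>) + h' (x \<bullet> \<xi>) * ((w \<bullet> \<xi>) * p \<xi>) \<partial>M)"
      by (simp add: inner_add_left algebra_simps)
    then show "?D (v + w) = ?D v + ?D w" using int by simp
  next
    fix r v
    have "?D (r *\<^sub>R v) = (\<integral>\<xi>. r * (h' (x \<bullet> \<xi>) * ((v \<bullet> \<xi>) * p \<xi>)) \<partial>M)"
      by (simp add: mult_ac)
    then show "?D (r *\<^sub>R v) = r *\<^sub>R ?D v" by simp
  qed
  then show "bounded_linear ?D" by (simp add: linear_conv_bounded_linear)
  fix e :: real assume e: "e > 0"
  obtain C where C: "C > 0" "\<And>\<xi>. norm \<xi> \<le> B \<Longrightarrow> \<bar>p \<xi>\<bar> \<le> C"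
    using continuous_on_bound[OF p] by blast
  define \<mu> where "\<mu> = measure M (space M) + 1"
  have \<mu>: "\<mu> > 0" by (simp add: \<mu>_def add_nonneg_pos)
  \<comment> \<open>Divides out the three factors collected later: \<open>B\<close> from the inner
    product, \<open>C\<close> from the weight \<open>p\<close>, and the total mass, enlarged by 1 to
    be positive.\<close>
  define e' where "e' = e / (B * C * \<mu>)"
  have e': "e' > 0" using e B_pos C \<mu> by (simp add: e'_def)
  \<comment> \<open>Contains x . \<xi> and y . \<xi> as soon as y is within distance 1 of x.\<close>
  define R where "R = B * (norm x + 1)"
  have "uniformly_continuous_on {-R..R} h'"
    by (intro compact_uniformly_continuous continuous_on_subset[OF h']) auto
  then obtain \<delta> where \<delta>: "\<delta> > 0" "\<And>s t. s \<in> {-R..R} \<Longrightarrow> t \<in> {-R..R} \<Longrightarrow> \<bar>t - s\<bar> < \<delta> \<Longrightarrow> \<bar>h' t - h' s\<bar> < e'"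
    unfolding uniformly_continuous_on_def dist_real_def using e' by metis
  show "\<exists>d>0. \<forall>y. norm (y - x) < d \<longrightarrow>
      norm ((\<integral>\<xi>. h (y \<bullet> \<xi>) * p \<xi> \<partial>M) - (\<integral>\<xi>. h (x \<bullet> \<xi>) * p \<xi> \<partial>M) - ?D (y - x)) \<le> e * norm (y - x)"
  proof (intro exI[of _ "min 1 (\<delta> / B)"] conjI allI impI)
    show "min 1 (\<delta> / B) > 0" using \<delta> B_pos by simp
    fix y assume "norm (y - x) < min 1 (\<delta> / B)"
    then have y: "norm (y - x) < 1" "B * norm (y - x) < \<delta>"
      using B_pos by (auto simp: field_simps)
    let ?r = "\<lambda>\<xi>. h (y \<bullet> \<xi>) * p \<xi> - h (x \<bullet> \<xi>) * p \<xi> - h' (x \<bullet> \<xi>) * (((y - x) \<bullet> \<xi>) * p \<xi>)"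
    have "\<bar>integral\<^sup>L M ?r\<bar> \<le> (\<integral>\<xi>. e' * (B * norm (y - x)) * C \<partial>M)"
    proof (rule order_trans[OF integral_abs_bound], rule integral_mono_AE)
      show "AE \<xi> in M. \<bar>?r \<xi>\<bar> \<le> e' * (B * norm (y - x)) * C"
        using AE_bound
      proof eventually_elim
        case (elim \<xi>)
        have xy: "\<bar>(y - x) \<bullet> \<xi>\<bar> \<le> B * norm (y - x)" using elim by (rule inner_bound)
        have x: "\<bar>x \<bullet> \<xi>\<bar> \<le> R" 
          using inner_bound[OF elim, of x] B_pos by (simp add: R_def algebra_simps)
        have "norm y \<le> norm x + 1" using y(1) norm_triangle_ineq2[of y x] by simp
        then have "B * norm y \<le> R" unfolding R_def using B_pos by simp
        with inner_bound[OF elim, of y] have y': "\<bar>y \<bullet> \<xi>\<bar> \<le> R" by simp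
        have "\<bar>h (y \<bullet> \<xi>) - h (x \<bullet> \<xi>) - h' (x \<bullet> \<xi>) * (y \<bullet> \<xi> - x \<bullet> \<xi>)\<bar> \<le> e' * \<bar>y \<bullet> \<xi> - x \<bullet> \<xi>\<bar>"
        proof (rule linearization_bound[OF h])
          fix z assume z: "z \<in> closed_segment (x \<bullet> \<xi>) (y \<bullet> \<xi>)"
          then have "\<bar>z - x \<bullet> \<xi>\<bar> \<le> \<bar>(y - x) \<bullet> \<xi>\<bar>"
            by (auto simp: closed_segment_eq_real_ivl inner_diff_left split: if_splits)
          then have "\<bar>z - x \<bullet> \<xi>\<bar> < \<delta>" using xy y(2) by simp
          moreover have "z \<in> {-R..R}" using z x y' by (auto simp: closed_segment_eq_real_ivl split: if_splits)
          moreover have "x \<bullet> \<xi> \<in> {-R..R}" using x by auto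
          ultimately show "\<bar>h' z - h' (x \<bullet> \<xi>)\<bar> \<le> e'" using \<delta>(2) by (meson less_imp_le)
        qed
        also have "\<dots> \<le> e' * (B * norm (y - x))"
          using xy e' by (simp add: inner_diff_left mult_left_mono)
        finally have "\<bar>h (y \<bullet> \<xi>) - h (x \<bullet> \<xi>) - h' (x \<bullet> \<xi>) * (y \<bullet> \<xi> - x \<bullet> \<xi>)\<bar> * \<bar>p \<xi>\<bar> \<le> e' * (B * norm (y - x)) * C"
          using C(2)[OF elim] e' B_pos by (intro mult_mono) auto
        moreover have "?r \<xi> = (h (y \<bullet> \<xi>) - h (x \<bullet> \<xi>) - h' (x \<bullet> \<xi>) * (y \<bullet> \<xi> - x \<bullet> \<xi>)) * p \<xi>"
          by (simp add: inner_diff_left algebra_simps)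
        ultimately show ?case by (simp only: abs_mult)
      qed
    qed (auto intro!: Bochner_Integration.integrable_diff integrable_abs integrable_ridge hc p int)
    also have "\<dots> = e * norm (y - x) * (measure M (space M) / \<mu>)"
      using B_pos C \<mu> by (simp add: e'_def)
    also have "\<dots> \<le> e * norm (y - x) * 1"
      using e \<mu> by (intro mult_left_mono) (auto simp: \<mu>_def)
    finally have "\<bar>integral\<^sup>L M ?r\<bar> \<le> e * norm (y - x)" by simp
    moreover have "integral\<^sup>L M ?r = (\<integral>\<xi>. h (y \<bullet> \<xi>) * p \<xi> \<partial>M) - (\<integral>\<xi>. h (x \<bullet> \<xi>) * p \<xi> \<partial>M) - ?D (y - x)"
      by (simp only: Bochner_Integration.integral_diff Bochner_Integration.integrable_diff integrable_ridge[OF hc p] int)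
    ultimately show "norm ((\<integral>\<xi>. h (y \<bullet> \<xi>) * p \<xi> \<partial>M) - (\<integral>\<xi>. h (x \<bullet> \<xi>) * p \<xi> \<partial>M) - ?D (y - x)) \<le> e * norm (y - x)"
      by simp
  qed
qed

lemma continuous_integral_ridge:
  fixes h :: "real \<Rightarrow> real" and p :: "'a \<Rightarrow> real"
  assumes h: "continuous_on UNIV h" and p: "continuous_on UNIV p"
  shows "continuous_on UNIV (\<lambda>x. \<integral>\<xi>. h (x \<bullet> \<xi>) * p \<xi> \<partial>M)"
  unfolding continuous_on_sequentially comp_def
proof (intro allI ballI impI, elim conjE)
  fix X :: "nat \<Rightarrow> 'a" and x assume X: "X \<longlonglongrightarrow> x"
  obtain C where C: "C > 0" "\<And>\<xi>. norm \<xi> \<le> B \<Longrightarrow> \<bar>p \<xi>\<bar> \<le> C"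
    using continuous_on_bound[OF p] by blast
  obtain K where K: "\<And>n. norm (X n) \<le> K"
    using X by (metis Bseq_def convergentI convergent_imp_Bseq)
  have "bounded (h ` {-(B * K)..B * K})"
    by (intro compact_imp_bounded compact_continuous_image continuous_on_subset[OF h]) auto
  then obtain D where D: "D > 0" "\<And>t. \<bar>t\<bar> \<le> B * K \<Longrightarrow> \<bar>h t\<bar> \<le> D"
    unfolding bounded_pos by (auto simp: abs_le_iff)
  show "(\<lambda>n. \<integral>\<xi>. h (X n \<bullet> \<xi>) * p \<xi> \<partial>M) \<longlonglongrightarrow> (\<integral>\<xi>. h (x \<bullet> \<xi>) * p \<xi> \<partial>M)"
  proof (rule integral_dominated_convergence[where w = "\<lambda>_. D * C"])
    show "AE \<xi> in M. (\<lambda>n. h (X n \<bullet> \<xi>) * p \<xi>) \<longlonglongrightarrow> h (x \<bullet> \<xi>) * p \<xi>"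
      using h X by (intro AE_I2 tendsto_intros isCont_tendsto_compose[of _ h])
        (auto simp: continuous_on_eq_continuous_at intro!: tendsto_intros)
    show "AE \<xi> in M. norm (h (X n \<bullet> \<xi>) * p \<xi>) \<le> D * C" for n
      using AE_bound
    proof eventually_elim
      case (elim \<xi>)
      have "\<bar>X n \<bullet> \<xi>\<bar> \<le> B * K"
        using inner_bound[OF elim, of "X n"] K[of n] B_pos by (meson mult_le_cancel_left_pos order_trans)
      then show ?case using D C(2)[OF elim] by (auto simp: abs_mult intro!: mult_mono)
    qed
  qed (use integrable_ridge[OF h p] in \<open>auto intro: borel_measurable_integrable\<close>)
qed

text \<open>The weight \<open>p\<close> keeps the class of integrals closed under partial
  derivatives: differentiating along b replaces \<open>h\<close> by h' and \<open>p\<close> by (b .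
  \<xi>) p, so the induction must run over all \<open>p\<close>.\<close>

lemma Ck_integral_ridge:
  fixes h :: "real \<Rightarrow> real" and p :: "'a \<Rightarrow> real"
  assumes "Ck k h" and "continuous_on UNIV p"
  shows "Ck k (\<lambda>x. \<integral>\<xi>. h (x \<bullet> \<xi>) * p \<xi> \<partial>M)"
  using assms
proof (induction k arbitrary: h p)
  case 0
  then show ?case by (simp add: continuous_integral_ridge)
next
  case (Suc k)
  define h' where "h' = (\<lambda>s. frechet_derivative h (at s) 1)"
  have h: "(h has_real_derivative h' s) (at s)" for s
  proof -
    obtain c where c: "(h has_real_derivative c) (at s)"
      using Suc.prems by (auto elim: real_differentiableE)
    then have "frechet_derivative h (at s) = (\<lambda>v. c * v)"
      by (metis frechet_derivative_at has_field_derivative_def)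
    with c show ?thesis by (simp add: h'_def)
  qed
  have Ck': "Ck k h'" using Suc.prems(1) unfolding Ck_Suc_real[OF h] .
  note D = has_derivative_integral_ridge[OF h Ck_imp_continuous[OF Ck'] Suc.prems(2)]
  have fd: "frechet_derivative (\<lambda>x. \<integral>\<xi>. h (x \<bullet> \<xi>) * p \<xi> \<partial>M) (at x) =
      (\<lambda>v. \<integral>\<xi>. h' (x \<bullet> \<xi>) * ((v \<bullet> \<xi>) * p \<xi>) \<partial>M)" for x
    using frechet_derivative_at[OF D] ..
  have "Ck k (\<lambda>x. \<integral>\<xi>. h' (x \<bullet> \<xi>) * ((b \<bullet> \<xi>) * p \<xi>) \<partial>M)" for b
    by (intro Suc.IH Ck' continuous_intros Suc.prems(2))
  then show ?case
    using D by (auto simp: fd differentiable_def)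
qed

end

section \<open>Convolution of the absolute value with an even bump\<close>

locale even_bump =
  fixes u :: "real \<Rightarrow> real" and R :: real
  assumes u_cont: "continuous_on UNIV u" and u_nonneg: "\<And>t. u t \<ge> 0" and u_even: "\<And>t. u (- t) = u t"
    and R_pos: "R > 0" and u_zero: "\<And>t. R \<le> \<bar>t\<bar> \<Longrightarrow> u t = 0" and u_int: "integral UNIV u = 1"
begin

lemma u_outside: "t \<notin> {-R..R} \<Longrightarrow> u t = 0"
  by (rule u_zero) auto

lemma has_integral_mult_u:
  fixes g :: "real \<Rightarrow> real"
  assumes g: "continuous_on UNIV g" and "R \<le> T"
  shows "((\<lambda>t. g t * u t) has_integral integral {-T..T} (\<lambda>t. g t * u t)) UNIV"
proof (rule has_integral_on_superset)
  show "((\<lambda>t. g t * u t) has_integral integral {-T..T} (\<lambda>t. g t * u t)) {-T..T}"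
    by (intro integrable_integral integrable_continuous_interval continuous_intros
        continuous_on_subset[OF g] continuous_on_subset[OF u_cont]) auto
  show "g t * u t = 0" if "t \<notin> {-T..T}" for t
    using that \<open>R \<le> T\<close> u_outside[of t] by auto
qed simp

lemma integrable_mult_u:
  fixes g :: "real \<Rightarrow> real"
  assumes g: "continuous_on UNIV g"
  shows "integrable lborel (\<lambda>t. g t * u t)"
proof -
  have "integrable lborel (\<lambda>t. indicator {-R..R} t *\<^sub>R (g t * u t))"
    by (intro borel_integrable_compact continuous_intros continuous_on_subset[OF g] continuous_on_subset[OF u_cont]) auto
  also have "(\<lambda>t. indicator {-R..R} t *\<^sub>R (g t * u t)) = (\<lambda>t. g t * u t)"
    using u_outside by (fastforce simp: indicator_def)
  finally show ?thesis .
qed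

lemma lborel_integral_mult_u:
  fixes g :: "real \<Rightarrow> real"
  assumes g: "continuous_on UNIV g"
  shows "(LBINT t. g t * u t) = integral UNIV (\<lambda>t. g t * u t)"
  using integral_lborel[OF integrable_mult_u[OF g]] by simp

lemma integral_odd_u:
  fixes g :: "real \<Rightarrow> real"
  assumes "\<And>t. g (- t) = - g t"
  shows "(LBINT t. g t * u t) = 0"
proof -
  have "(LBINT t. g t * u t) = (LBINT t. g (- t) * u (- t))"
    using lborel_integral_real_affine[of "-1" "\<lambda>t. g t * u t" 0] by simp
  also have "\<dots> = - (LBINT t. g t * u t)" by (simp add: assms u_even)
  finally show ?thesis by simp
qed

lemma lborel_integral_u: "(LBINT t. u t) = 1"
  using lborel_integral_mult_u[of "\<lambda>_. 1"] u_int by simp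

lemma abs_conv_lborel: "abs_conv u s = (LBINT t. \<bar>s - t\<bar> * u t)"
  unfolding abs_conv_def by (rule lborel_integral_mult_u[symmetric]) (intro continuous_intros)

lemma abs_conv_even: "abs_conv u (- s) = abs_conv u s"
proof -
  have "abs_conv u (- s) = (LBINT t. \<bar>- s - (- t)\<bar> * u (- t))"
    unfolding abs_conv_lborel using lborel_integral_real_affine[of "-1" "\<lambda>t. \<bar>- s - t\<bar> * u t" 0] by simp
  then show ?thesis unfolding abs_conv_lborel u_even by (simp add: abs_minus_commute)
qed

text \<open>For s at least \<open>R\<close> the function |s - t| equals s - t on the support of
  \<open>u\<close>, whose mass is 1 and whose first moment vanishes by evenness.\<close>

lemma abs_conv_eq_abs:
  assumes "R \<le> \<bar>s\<bar>" shows "abs_conv u s = \<bar>s\<bar>"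
proof -
  have *: "abs_conv u s = s" if "R \<le> s" for s
  proof -
    have "abs_conv u s = (LBINT t. s * u t - t * u t)"
      unfolding abs_conv_lborel
    proof (rule Bochner_Integration.integral_cong[OF refl])
      fix t show "\<bar>s - t\<bar> * u t = s * u t - t * u t"
        using that u_zero[of t] by (cases "t \<le> s") (auto simp: left_diff_distrib)
    qed
    also have "\<dots> = s * (LBINT t. u t) - (LBINT t. t * u t)"
      using integrable_mult_u[of "\<lambda>_. s"] integrable_mult_u[of "\<lambda>t. t"] by simp
    finally show ?thesis by (simp add: lborel_integral_u integral_odd_u)
  qed
  show ?thesis using *[of s] *[of "- s"] assms by (auto simp: abs_conv_even abs_if split: if_splits)
qed

text \<open>The explicit derivative involves an auxiliary cut-off \<open>T\<close> that grows with
  s; \<open>deriv\<close> packages these local formulas into one global function.\<close>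

definition abs_conv' :: "real \<Rightarrow> real" where "abs_conv' = deriv (abs_conv u)"

text \<open>Splitting the convolution at s leaves 2 (s A(s) - Q(s)) - s, with A and Q the partial
  integrals of u and of t u(t), since A(T) = 1 and Q(T) = 0. On differentiation the two terms s u(s)
  cancel.\<close>

lemma abs_conv_deriv_local:
  assumes s: "\<bar>s\<bar> < T" and T: "R \<le> T"
  shows "(abs_conv u has_real_derivative 2 * integral {-T..s} u - 1) (at s)"
proof -
  let ?A = "\<lambda>s. integral {-T..s} u" and ?Q = "\<lambda>s. integral {-T..s} (\<lambda>t. t * u t)"
  have uc: "continuous_on S u" for S by (rule continuous_on_subset[OF u_cont]) auto
  have ui: "u integrable_on {a..b}" "(\<lambda>t. t * u t) integrable_on {a..b}" "(\<lambda>t. s * u t) integrable_on {a..b}" for a b s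
    by (intro integrable_continuous_interval continuous_intros uc)+
  have A1: "?A T = 1"
    using has_integral_mult_u[of "\<lambda>_. 1", OF _ T] u_int by (auto dest: integral_unique)
  have Q0: "?Q T = 0"
    using has_integral_mult_u[of "\<lambda>t. t", OF _ T] integral_odd_u[of "\<lambda>t. t"] lborel_integral_mult_u[of "\<lambda>t. t"]
    by (auto dest: integral_unique)
  have eq: "abs_conv u s = 2 * (s * ?A s - ?Q s) - s" if "s \<in> {-T<..<T}" for s
  proof -
    have "abs_conv u s = integral {-T..T} (\<lambda>t. \<bar>s - t\<bar> * u t)"
      unfolding abs_conv_def by (intro integral_unique has_integral_mult_u[OF _ T] continuous_intros)
    also have "\<dots> = integral {-T..s} (\<lambda>t. \<bar>s - t\<bar> * u t) + integral {s..T} (\<lambda>t. \<bar>s - t\<bar> * u t)"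
      using that by (intro Henstock_Kurzweil_Integration.integral_combine[symmetric] integrable_continuous_interval continuous_intros uc) auto
    also have "integral {-T..s} (\<lambda>t. \<bar>s - t\<bar> * u t) = integral {-T..s} (\<lambda>t. s * u t - t * u t)"
      by (intro integral_cong) (auto simp: algebra_simps)
    also have "\<dots> = s * ?A s - ?Q s"
      by (subst Henstock_Kurzweil_Integration.integral_diff) (use ui in auto)
    also have "integral {s..T} (\<lambda>t. \<bar>s - t\<bar> * u t) = integral {s..T} (\<lambda>t. t * u t - s * u t)"
      by (intro integral_cong) (auto simp: algebra_simps)
    also have "\<dots> = integral {s..T} (\<lambda>t. t * u t) - s * integral {s..T} u"
      by (subst Henstock_Kurzweil_Integration.integral_diff) (use ui in auto)
    also have "integral {s..T} (\<lambda>t. t * u t) = ?Q T - ?Q s"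
      using Henstock_Kurzweil_Integration.integral_combine[of "-T" s T "\<lambda>t. t * u t"] that ui by simp
    also have "integral {s..T} u = ?A T - ?A s"
      using Henstock_Kurzweil_Integration.integral_combine[of "-T" s T u] that ui by simp
    finally show ?thesis by (simp add: A1 Q0 algebra_simps)
  qed
  have sT: "s \<in> {-T<..<T}" using s by auto
  have "(?A has_real_derivative u s) (at s within {-T..T})"
    using sT uc by (intro integral_has_real_derivative) auto
  moreover have "(?Q has_real_derivative s * u s) (at s within {-T..T})"
    using sT uc by (intro integral_has_real_derivative continuous_intros) auto
  moreover have "at s within {-T..T} = at s"
    using sT by (intro at_within_interior) (simp add: interior_atLeastAtMost_real)
  ultimately have "((\<lambda>s. 2 * (s * ?A s - ?Q s) - s) has_real_derivative 2 * ?A s - 1) (at s)"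
    by (auto intro!: derivative_eq_intros)
  then show ?thesis
    by (rule has_field_derivative_transform_within_open[of _ _ _ "{-T<..<T}"]) (use sT eq in auto)
qed

lemma abs_conv_deriv: "(abs_conv u has_real_derivative abs_conv' s) (at s)"
  using abs_conv_deriv_local[of s "\<bar>s\<bar> + R"] R_pos unfolding abs_conv'_def
  by (simp add: DERIV_imp_deriv)

lemma abs_conv'_deriv: "(abs_conv' has_real_derivative 2 * u s) (at s)"
proof -
  define T where "T = \<bar>s\<bar> + R"
  have T: "s \<in> {-T<..<T}" "R \<le> T" using R_pos by (auto simp: T_def)
  have "((\<lambda>s. integral {-T..s} u) has_real_derivative u s) (at s within {-T..T})"
    using T continuous_on_subset[OF u_cont] by (intro integral_has_real_derivative) auto
  moreover have "at s within {-T..T} = at s"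
    using T by (intro at_within_interior) (simp add: interior_atLeastAtMost_real)
  ultimately have "((\<lambda>s. 2 * integral {-T..s} u - 1) has_real_derivative 2 * u s) (at s)"
    by (auto intro!: derivative_eq_intros)
  then show ?thesis
  proof (rule has_field_derivative_transform_within_open[of _ _ _ "{-T<..<T}"])
    fix s assume "s \<in> {-T<..<T}"
    then have "\<bar>s\<bar> < T" by auto
    from DERIV_imp_deriv[OF abs_conv_deriv_local[OF this T(2)]]
    show "2 * integral {-T..s} u - 1 = abs_conv' s"
      unfolding abs_conv'_def ..
  qed (use T in auto)
qed

lemma abs_conv_continuous: "continuous_on S (abs_conv u)"
  using abs_conv_deriv by (meson DERIV_isCont continuous_at_imp_continuous_on)

lemma abs_conv_convex: "convex_on UNIV (abs_conv u)"
  by (rule f''_ge0_imp_convex[where f' = abs_conv' and f'' = "\<lambda>s. 2 * u s"])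
     (auto simp: abs_conv_deriv abs_conv'_deriv u_nonneg)

text \<open>0 is the midpoint of s and - s, where an even function takes the same value. This gives
  the uniform negative bound on \<open>f\<close>.\<close>

lemma abs_conv_ge_0: "abs_conv u 0 \<le> abs_conv u s"
  using convex_onD[OF abs_conv_convex, of "1/2" s "- s"] by (simp add: abs_conv_even)

text \<open>A vanishing first absolute moment would force u = 0 off the origin, contradicting total
  mass 1.\<close>

lemma abs_conv_0_pos: "abs_conv u 0 > 0"
proof (rule ccontr)
  assume "\<not> ?thesis"
  moreover have "abs_conv u 0 = integral {-R..R} (\<lambda>t. \<bar>t\<bar> * u t)"
    unfolding abs_conv_def diff_0 abs_minus_cancel
    by (intro integral_unique has_integral_mult_u continuous_intros order_refl)
  moreover have "integral {-R..R} (\<lambda>t. \<bar>t\<bar> * u t) \<ge> 0"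
    by (rule integral_nonneg)
       (auto simp: u_nonneg intro!: integrable_continuous_interval continuous_intros continuous_on_subset[OF u_cont])
  ultimately have "integral {-R..R} (\<lambda>t. \<bar>t\<bar> * u t) = 0" by simp
  then have "\<forall>t\<in>{-R..R}. \<bar>t\<bar> * u t = 0"
    using R_pos by (subst (asm) integral_eq_0_iff)
      (auto simp: u_nonneg intro!: continuous_intros continuous_on_subset[OF u_cont])
  then have "u t = 0" if "t \<noteq> 0" for t
    using that u_outside[of t] by (cases "t \<in> {-R..R}") auto
  then have "integral UNIV u = integral UNIV (\<lambda>_. 0 :: real)"
    using integral_spike[of "{0}" UNIV "\<lambda>_. 0" u] by simp
  then show False using u_int by simp
qed

lemma le_sup_norm: "u t \<le> sup_norm u"
proof -
  have "bounded (u ` {-R..R})"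
    by (intro compact_imp_bounded compact_continuous_image continuous_on_subset[OF u_cont]) auto
  then obtain C where C: "C > 0" "\<And>t. t \<in> {-R..R} \<Longrightarrow> \<bar>u t\<bar> \<le> C"
    unfolding bounded_pos by auto
  have "\<bar>u t\<bar> \<le> C" for t
    using C u_outside[of t] by (cases "t \<in> {-R..R}") auto
  then have "bdd_above (range (\<lambda>t. \<bar>u t\<bar>))" by (auto intro!: bdd_aboveI)
  then have "\<bar>u t\<bar> \<le> sup_norm u"
    unfolding sup_norm_def by (rule cSUP_upper[OF UNIV_I])
  then show ?thesis by simp
qed

text \<open>The second derivative is 2 (\<open>sup_norm u\<close> - u), hence nonnegative.\<close>

lemma semiconvex: "convex_on UNIV (\<lambda>s. sup_norm u * s\<^sup>2 - abs_conv u s)"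
proof (rule f''_ge0_imp_convex[where f' = "\<lambda>s. sup_norm u * (2 * s) - abs_conv' s" and f'' = "\<lambda>s. sup_norm u * 2 - 2 * u s"])
  fix s
  show "((\<lambda>s. sup_norm u * s\<^sup>2 - abs_conv u s) has_real_derivative sup_norm u * (2 * s) - abs_conv' s) (at s)"
    by (auto intro!: derivative_eq_intros abs_conv_deriv)
  show "((\<lambda>s. sup_norm u * (2 * s) - abs_conv' s) has_real_derivative sup_norm u * 2 - 2 * u s) (at s)"
    by (auto intro!: derivative_eq_intros abs_conv'_deriv)
qed (use le_sup_norm in auto)

lemma abs_conv'_lipschitz: "\<bar>abs_conv' s - abs_conv' t\<bar> \<le> 2 * sup_norm u * \<bar>s - t\<bar>"
proof -
  have "norm (abs_conv' s - abs_conv' t) \<le> 2 * sup_norm u * norm (s - t)"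
    by (rule field_differentiable_bound[of UNIV abs_conv' "\<lambda>s. 2 * u s"])
       (use abs_conv'_deriv le_sup_norm u_nonneg in auto)
  then show ?thesis by simp
qed

end

section \<open>Spectral representation of the absolute value and negative type\<close>

definition cos_kernel :: "real \<Rightarrow> real \<Rightarrow> real" where
  "cos_kernel y \<omega> = (1 - cos (y * \<omega>)) / \<omega>\<^sup>2"

lemma cos_kernel_nonneg: "cos_kernel y \<omega> \<ge> 0"
  by (simp add: cos_kernel_def)

text \<open>Near 0 the numerator is at most y^2 \<omega>^2 / 2, far away at most 2; adding both
  estimates gives an integrable majorant. At \<omega> = 0 the quotient is 0 by the convention for
  division.\<close>

lemma cos_kernel_bound: "cos_kernel y \<omega> \<le> (4 + y\<^sup>2) * inverse (1 + \<omega>\<^sup>2)"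
proof (cases "\<omega> = 0")
  case True
  then show ?thesis by (simp add: cos_kernel_def)
next
  case False
  define a where "a = 1 - cos (y * \<omega>)"
  have "a = 2 * (sin (y * \<omega> / 2))\<^sup>2"
    using cos_double_sin[of "y * \<omega> / 2"] by (simp add: a_def)
  also have "(sin (y * \<omega> / 2))\<^sup>2 \<le> (y * \<omega> / 2)\<^sup>2"
    using abs_sin_x_le_abs_x[of "y * \<omega> / 2"] by (rule abs_le_square_iff[THEN iffD1])
  finally have 1: "2 * a \<le> y\<^sup>2 * \<omega>\<^sup>2" by (simp add: power_mult_distrib power_divide mult.commute)
  have 2: "a * \<omega>\<^sup>2 \<le> 2 * \<omega>\<^sup>2" by (intro mult_right_mono) (simp_all add: a_def minus_le_iff)
  have "a \<ge> 0" by (simp add: a_def)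
  have pos: "1 + \<omega>\<^sup>2 > 0" by (simp add: add_pos_nonneg)
  have "a * (1 + \<omega>\<^sup>2) \<le> (4 + y\<^sup>2) * \<omega>\<^sup>2"
  proof -
    have "a \<le> y\<^sup>2 * \<omega>\<^sup>2" using 1 \<open>a \<ge> 0\<close> by simp
    moreover have "a * \<omega>\<^sup>2 \<le> 4 * \<omega>\<^sup>2" using 2 zero_le_power2[of \<omega>] by linarith
    ultimately show ?thesis unfolding distrib_left distrib_right by simp
  qed
  then have "a / \<omega>\<^sup>2 \<le> (4 + y\<^sup>2) / (1 + \<omega>\<^sup>2)"
    using False pos by (simp add: pos_divide_le_eq pos_le_divide_eq frac_le_eq divide_simps)
  then show ?thesis by (simp add: cos_kernel_def a_def divide_inverse)
qed

lemma integral_nonpos: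
  fixes f :: "'a \<Rightarrow> real"
  assumes "\<And>x. f x \<le> 0" shows "integral\<^sup>L M f \<le> 0"
proof -
  have "(\<integral>x. - f x \<partial>M) \<ge> 0"
    using assms by (intro Bochner_Integration.integral_nonneg) simp
  then show ?thesis by simp
qed

lemma cos_kernel_integrable: "integrable lborel (cos_kernel y)"
proof (rule Bochner_Integration.integrable_bound)
  show "integrable lborel (\<lambda>\<omega>::real. (4 + y\<^sup>2) * inverse (1 + \<omega>\<^sup>2))"
    using integrable_inverse_1_plus_square by (intro integrable_mult_right) (simp add: set_integrable_def)
  show "cos_kernel y \<in> borel_measurable lborel"
    unfolding cos_kernel_def by measurable
  show "AE \<omega> in lborel. norm (cos_kernel y \<omega>) \<le> norm ((4 + y\<^sup>2) * inverse (1 + \<omega>\<^sup>2))"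
    by (intro AE_I2) (smt (verit) cos_kernel_bound cos_kernel_nonneg real_norm_def)
qed

definition kernel_mass :: real where "kernel_mass = (LBINT \<omega>. cos_kernel 1 \<omega>)"

text \<open>By scaling, the integral is a multiple of \<open>\<bar>y\<bar>\<close>; only positivity of the constant matters.\<close>

lemma cos_kernel_integral: "(LBINT \<omega>. cos_kernel y \<omega>) = kernel_mass * \<bar>y\<bar>"
proof (cases "y = 0")
  case True
  then show ?thesis by (simp add: cos_kernel_def)
next
  case False
  have "(LBINT \<omega>. cos_kernel y \<omega>) = \<bar>1 / y\<bar> *\<^sub>R (LBINT x. cos_kernel y (0 + 1 / y * x))"
    using False by (intro lborel_integral_real_affine) auto
  also have "(\<lambda>x. cos_kernel y (0 + 1 / y * x)) = (\<lambda>x. y\<^sup>2 * cos_kernel 1 x)"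
    using False by (auto simp: cos_kernel_def power_divide)
  also have "\<bar>1 / y\<bar> *\<^sub>R (LBINT x. y\<^sup>2 * cos_kernel 1 x) = kernel_mass * \<bar>y\<bar>"
    using False by (simp add: kernel_mass_def power2_eq_square abs_if)
  finally show ?thesis .
qed

text \<open>On [1, 2] cosine is at most cos 1 and \<omega>^2 at most 4, so the kernel dominates a
  positive constant there.\<close>

lemma kernel_mass_pos: "kernel_mass > 0"
proof -
  have "(1 - cos 1) / 4 * indicator {1..2::real} \<omega> \<le> cos_kernel 1 \<omega>" for \<omega>
  proof (cases "\<omega> \<in> {1..2}")
    case True
    then have "cos \<omega> \<le> cos 1" using pi_gt3 by (intro cos_monotone_0_pi_le) auto
    moreover have "\<omega>\<^sup>2 \<le> 2\<^sup>2" using True by (intro power_mono) auto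
    ultimately have "(1 - cos 1) / 4 \<le> (1 - cos \<omega>) / \<omega>\<^sup>2"
      using True by (intro frac_le) auto
    then show ?thesis using True by (simp add: cos_kernel_def)
  qed (simp add: cos_kernel_nonneg)
  then have "(LBINT \<omega>. (1 - cos 1) / 4 * indicator {1..2::real} \<omega>) \<le> kernel_mass"
    unfolding kernel_mass_def by (intro integral_mono cos_kernel_integrable) auto
  moreover have "(LBINT \<omega>. (1 - cos 1) / 4 * indicator {1..2::real} \<omega>) = (1 - cos 1) / (4 :: real)"
    by simp
  moreover have "cos 1 < (1::real)" using cos_monotone_0_pi[of 0 1] pi_gt3 by simp
  ultimately show ?thesis by simp
qed

context even_bump begin

definition cos_transform :: "real \<Rightarrow> real" where
  "cos_transform \<omega> = (LBINT t. cos (t * \<omega>) * u t)"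

text \<open>Represents |s - t| by the kernel and exchanges the integrals, which is legitimate since
  the integrand is nonnegative. After the addition theorem, the sine part drops out because
  \<open>u\<close> is even.\<close>

lemma abs_conv_kernel:
  "integrable lborel (\<lambda>\<omega>. (1 - cos (s * \<omega>) * cos_transform \<omega>) / \<omega>\<^sup>2)"
  "kernel_mass * abs_conv u s = (LBINT \<omega>. (1 - cos (s * \<omega>) * cos_transform \<omega>) / \<omega>\<^sup>2)"
proof -
  define f where "f = (\<lambda>t \<omega>. cos_kernel (s - t) \<omega> * u t)"
  have [measurable]: "u \<in> borel_measurable borel" using u_cont by (rule borel_measurable_continuous_onI)
  have int1: "(LBINT \<omega>. f t \<omega>) = kernel_mass * (\<bar>s - t\<bar> * u t)" for t
    by (simp add: f_def cos_kernel_integral)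
  have "integrable lborel (\<lambda>t. \<bar>s - t\<bar> * u t)"
    by (intro integrable_mult_u continuous_intros)
  then have int2: "integrable lborel (\<lambda>t. LBINT \<omega>. f t \<omega>)" unfolding int1 by simp
  have fm: "case_prod f \<in> borel_measurable (lborel \<Otimes>\<^sub>M lborel)"
    unfolding f_def cos_kernel_def by measurable
  have F: "integrable (lborel \<Otimes>\<^sub>M lborel) (case_prod f)"
  proof (rule lborel_pair.Fubini_integrable[OF fm])
    have "norm (f t \<omega>) = f t \<omega>" for t \<omega> by (simp add: f_def cos_kernel_nonneg u_nonneg)
    then show "integrable lborel (\<lambda>t. LBINT \<omega>. norm (case (t, \<omega>) of (t, \<omega>) \<Rightarrow> f t \<omega>))"
      using int2 by simp
    show "AE t in lborel. integrable lborel (\<lambda>\<omega>. case (t, \<omega>) of (t, \<omega>) \<Rightarrow> f t \<omega>)"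
      by (simp add: f_def cos_kernel_integrable)
  qed
  have inner: "(LBINT t. f t \<omega>) = (1 - cos (s * \<omega>) * cos_transform \<omega>) / \<omega>\<^sup>2" for \<omega>
  proof -
    have i: "integrable lborel (\<lambda>t. cos (t * \<omega>) * u t)" "integrable lborel (\<lambda>t. sin (t * \<omega>) * u t)" "integrable lborel u"
      using integrable_mult_u[of "\<lambda>_. 1"] by (auto intro!: integrable_mult_u continuous_intros)
    have "f t \<omega> = (u t - cos (s * \<omega>) * (cos (t * \<omega>) * u t) - sin (s * \<omega>) * (sin (t * \<omega>) * u t)) / \<omega>\<^sup>2" for t
      unfolding f_def cos_kernel_def left_diff_distrib cos_diff by (simp add: algebra_simps diff_divide_distrib add_divide_distrib)
    then have "(LBINT t. f t \<omega>) = ((LBINT t. u t) - cos (s * \<omega>) * (LBINT t. cos (t * \<omega>) * u t)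
        - sin (s * \<omega>) * (LBINT t. sin (t * \<omega>) * u t)) / \<omega>\<^sup>2"
      using i by simp
    then show ?thesis by (simp add: lborel_integral_u integral_odd_u cos_transform_def)
  qed
  show "integrable lborel (\<lambda>\<omega>. (1 - cos (s * \<omega>) * cos_transform \<omega>) / \<omega>\<^sup>2)"
    using lborel_pair.integrable_snd[OF F] by (simp add: inner)
  have "kernel_mass * abs_conv u s = (LBINT t. LBINT \<omega>. f t \<omega>)"
    unfolding int1 abs_conv_lborel by simp
  also have "\<dots> = (LBINT \<omega>. LBINT t. f t \<omega>)"
    using F by (rule lborel_pair.Fubini_integral[symmetric])
  finally show "kernel_mass * abs_conv u s = (LBINT \<omega>. (1 - cos (s * \<omega>) * cos_transform \<omega>) / \<omega>\<^sup>2)"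
    by (simp add: inner)
qed

text \<open>Since the coefficients sum to zero, the term 1 / \<omega>^2 contributes nothing, and the
  cosine sum is a sum of two squares multiplied by the nonnegative transform.\<close>

lemma abs_conv_neg_type:
  fixes x \<alpha> :: "nat \<Rightarrow> real"
  assumes C: "\<And>\<omega>. cos_transform \<omega> \<ge> 0" and \<alpha>: "(\<Sum>j<N. \<alpha> j) = 0"
  shows "(\<Sum>j<N. \<Sum>k<N. \<alpha> j * \<alpha> k * abs_conv u (x j - x k)) \<le> 0"
proof -
  let ?q = "\<lambda>s \<omega>. (1 - cos (s * \<omega>) * cos_transform \<omega>) / \<omega>\<^sup>2"
  have "kernel_mass * (\<Sum>j<N. \<Sum>k<N. \<alpha> j * \<alpha> k * abs_conv u (x j - x k)) =
      (\<Sum>j<N. \<Sum>k<N. \<alpha> j * \<alpha> k * (kernel_mass * abs_conv u (x j - x k)))"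
    by (simp add: sum_distrib_left mult_ac)
  also have "\<dots> = (LBINT \<omega>. (\<Sum>j<N. \<Sum>k<N. \<alpha> j * \<alpha> k * ?q (x j - x k) \<omega>))"
    unfolding abs_conv_kernel(2) using abs_conv_kernel(1) by (simp del: times_divide_eq_right)
  also have "\<dots> \<le> 0"
  proof (rule integral_nonpos)
    fix \<omega>
    have "(\<Sum>j<N. \<Sum>k<N. \<alpha> j * \<alpha> k * ?q (x j - x k) \<omega>) =
        ((\<Sum>j<N. \<Sum>k<N. \<alpha> j * \<alpha> k) - cos_transform \<omega> * (\<Sum>j<N. \<Sum>k<N. \<alpha> j * \<alpha> k * cos ((x j - x k) * \<omega>))) / \<omega>\<^sup>2"
      by (simp add: sum_distrib_left sum_divide_distrib sum_subtractf[symmetric] algebra_simps diff_divide_distrib)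
    also have "(\<Sum>j<N. \<Sum>k<N. \<alpha> j * \<alpha> k) = 0"
      using \<alpha> by (simp add: sum_distrib_left[symmetric])
    also have "(\<Sum>j<N. \<Sum>k<N. \<alpha> j * \<alpha> k * cos ((x j - x k) * \<omega>)) =
        (\<Sum>j<N. \<alpha> j * cos (x j * \<omega>))\<^sup>2 + (\<Sum>j<N. \<alpha> j * sin (x j * \<omega>))\<^sup>2"
      unfolding power2_eq_square sum_product sum.distrib[symmetric] left_diff_distrib cos_diff
      by (intro sum.cong refl) (simp add: algebra_simps)
    finally show "(\<Sum>j<N. \<Sum>k<N. \<alpha> j * \<alpha> k * ?q (x j - x k) \<omega>) \<le> 0"
      using C[of \<omega>] by (simp add: divide_nonpos_nonneg)
  qed
  finally show ?thesis using kernel_mass_pos by (simp add: mult_le_0_iff)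
qed

text \<open>Translates the sign condition of \<open>U_class\<close> to the cosine transform; 2 pi is
  the frequency normalisation in \<open>fourier\<close>.\<close>

lemma Re_fourier: "Re (fourier u w) = cos_transform (2 * pi * w)"
proof -
  let ?g = "\<lambda>x. exp (- 2 * pi * \<i> * complex_of_real (x * w)) * complex_of_real (u x)"
  have "?g integrable_on UNIV"
  proof (rule integrable_on_superset[of _ "{-R..R}"])
    show "?g integrable_on {-R..R}"
      by (intro integrable_continuous_interval continuous_intros continuous_on_subset[OF u_cont]) auto
    show "?g x = 0" if "x \<notin> {-R..R}" for x using that u_outside[of x] by simp
  qed auto
  then have "Re (fourier u w) = integral UNIV (Re \<circ> ?g)"
    unfolding fourier_def by (rule integral_linear[symmetric]) (rule bounded_linear_Re)
  also have "Re \<circ> ?g = (\<lambda>x. cos (x * (2 * pi * w)) * u x)"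
    by (auto simp: Re_exp mult_ac)
  finally show ?thesis
    unfolding cos_transform_def by (subst lborel_integral_mult_u) (auto intro!: continuous_intros)
qed

end

text \<open>For a symmetric kernel the imaginary part cancels, and the real part is the sum of the
  quadratic forms of Re a and Im a, each of which also sums to zero.\<close>

lemma CP1_I:
  fixes g :: "'a::euclidean_space \<Rightarrow> real"
  assumes "continuous_on UNIV g" and even: "\<And>x. g (- x) = g x"
    and psd: "\<And>N x \<alpha>. (\<Sum>j<N. \<alpha> j) = 0 \<Longrightarrow> (\<Sum>j<(N::nat). \<Sum>k<N. \<alpha> j * \<alpha> k * g (x j - x k)) \<ge> 0"
  shows "g \<in> CP1"
proof -
  have "Im (\<Sum>j<N. \<Sum>k<N. a j * cnj (a k) * complex_of_real (g (x j - x k))) = 0 \<and>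
        Re (\<Sum>j<N. \<Sum>k<N. a j * cnj (a k) * complex_of_real (g (x j - x k))) \<ge> 0"
    if a: "(\<Sum>j<N. a j) = 0" for N :: nat and x :: "nat \<Rightarrow> 'a" and a :: "nat \<Rightarrow> complex"
  proof
    have sym: "g (x k - x j) = g (x j - x k)" for j k
      using even[of "x j - x k"] by simp
    have "(\<Sum>j<N. \<Sum>k<N. Re (a j) * Im (a k) * g (x j - x k)) = (\<Sum>k<N. \<Sum>j<N. Re (a j) * Im (a k) * g (x j - x k))"
      by (rule sum.swap)
    then have "(\<Sum>j<N. \<Sum>k<N. Re (a j) * Im (a k) * g (x j - x k)) = (\<Sum>j<N. \<Sum>k<N. Im (a j) * Re (a k) * g (x j - x k))"
      by (simp add: sym mult_ac)
    then show "Im (\<Sum>j<N. \<Sum>k<N. a j * cnj (a k) * complex_of_real (g (x j - x k))) = 0"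
      by (simp add: left_diff_distrib sum_subtractf)
    have "(\<Sum>j<N. Re (a j)) = 0" "(\<Sum>j<N. Im (a j)) = 0"
      using a by (simp_all flip: Re_sum Im_sum)
    from psd[OF this(1), of x] psd[OF this(2), of x]
    show "Re (\<Sum>j<N. \<Sum>k<N. a j * cnj (a k) * complex_of_real (g (x j - x k))) \<ge> 0"
      by (simp add: distrib_right sum.distrib)
  qed
  then show ?thesis unfolding CP1_def Let_def using assms by blast
qed

section \<open>Properties of the average\<close>

lemma cos_avg_cont:
  assumes h: "continuous_on UNIV h"
  shows "continuous_on UNIV (cos_avg m h)"
proof -
  have "continuous_on (UNIV \<times> cbox 0 pi) (\<lambda>(s, \<theta>). h (s * cos \<theta>) * sin \<theta> ^ m)"
    unfolding split_beta
    by (intro continuous_on_mult continuous_on_compose_UNIV[OF h] continuous_intros)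
  then have "continuous_on UNIV (\<lambda>s. integral (cbox 0 pi) (\<lambda>\<theta>. h (s * cos \<theta>) * sin \<theta> ^ m))"
    by (rule integral_continuous_on_param)
  then show ?thesis
    unfolding cos_avg_def using trig_int_0_pos[of m] by (intro continuous_intros) auto
qed

lemma cos_avg_const: "cos_avg m (\<lambda>_. c) s = c"
  using trig_int_0_pos[of m] by (simp add: cos_avg_def trig_int_def)

text \<open>Provides the second moment bound for x . \<xi>; the crude estimate |cos \<theta>| <= 1
  is enough for the constant \<open>L\<close>.\<close>

lemma cos_avg_square_le: "cos_avg m (\<lambda>t. t\<^sup>2) s \<le> s\<^sup>2"
proof -
  have "integral {0..pi} (\<lambda>\<theta>. (s * cos \<theta>)\<^sup>2 * sin \<theta> ^ m) \<le> integral {0..pi} (\<lambda>\<theta>. s\<^sup>2 * sin \<theta> ^ m)"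
  proof (rule integral_le)
    fix \<theta> :: real assume "\<theta> \<in> {0..pi}"
    then have "sin \<theta> ^ m \<ge> 0" by (simp add: sin_ge_zero)
    moreover have "(s * cos \<theta>)\<^sup>2 \<le> s\<^sup>2 * 1"
      unfolding power_mult_distrib by (intro mult_left_mono) (auto simp: abs_square_le_1)
    ultimately show "(s * cos \<theta>)\<^sup>2 * sin \<theta> ^ m \<le> s\<^sup>2 * sin \<theta> ^ m"
      by (simp add: mult_right_mono)
  qed (intro integrable_continuous_interval continuous_intros)+
  also have "\<dots> = s\<^sup>2 * trig_int 0 m" by (simp add: trig_int_def)
  finally show ?thesis
    using trig_int_0_pos[of m] by (simp add: cos_avg_def pos_divide_le_eq)
qed

lemma cos_avg_diff:
  assumes "continuous_on UNIV g" "continuous_on UNIV h"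
  shows "cos_avg m (\<lambda>t. g t - h t) s = cos_avg m g s - cos_avg m h s"
  unfolding cos_avg_def left_diff_distrib
  by (subst Henstock_Kurzweil_Integration.integral_diff)
     (simp_all add: cos_avg_integrable assms diff_divide_distrib)

lemma cos_avg_minus: "cos_avg m (\<lambda>t. - h t) s = - cos_avg m h s"
  by (simp add: cos_avg_def)

text \<open>Each half of [0, pi] contributes 1 / (m+1) by an explicit antiderivative. With m = d - 2
  the normalised total is C_d |s|.\<close>

lemma cos_avg_abs:
  "cos_avg m abs s = Gamma ((real m + 2) / 2) / (sqrt pi * Gamma ((real m + 3) / 2)) * \<bar>s\<bar>"
proof -
  let ?F = "\<lambda>\<theta>. sin \<theta> ^ (m + 1) / real (m + 1)"
  have d: "(?F has_vector_derivative cos \<theta> * sin \<theta> ^ m) (at \<theta> within S)" for \<theta> S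
  proof -
    have "(?F has_real_derivative cos \<theta> * sin \<theta> ^ m) (at \<theta> within S)"
      by (rule derivative_eq_intros refl | simp)+
    then show ?thesis by (simp add: has_real_derivative_iff_has_vector_derivative)
  qed
  have "((\<lambda>\<theta>. cos \<theta> * sin \<theta> ^ m) has_integral (?F (pi/2) - ?F 0)) {0..pi/2}"
    by (rule fundamental_theorem_of_calculus) (simp, rule d)
  then have 1: "((\<lambda>\<theta>. \<bar>cos \<theta>\<bar> * sin \<theta> ^ m) has_integral 1 / real (m + 1)) {0..pi/2}"
    by (rule has_integral_eq_rhs[OF has_integral_eq, rotated]) (auto simp: cos_ge_zero)
  have "((\<lambda>\<theta>. - (cos \<theta> * sin \<theta> ^ m)) has_integral - (?F pi - ?F (pi/2))) {pi/2..pi}"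
    by (intro has_integral_neg fundamental_theorem_of_calculus d) simp
  then have 2: "((\<lambda>\<theta>. \<bar>cos \<theta>\<bar> * sin \<theta> ^ m) has_integral 1 / real (m + 1)) {pi/2..pi}"
  proof (rule has_integral_eq_rhs[OF has_integral_eq, rotated])
    fix \<theta> assume "\<theta> \<in> {pi/2..pi}"
    then have "cos \<theta> \<le> cos (pi/2)" by (intro cos_monotone_0_pi_le) auto
    then show "- (cos \<theta> * sin \<theta> ^ m) = \<bar>cos \<theta>\<bar> * sin \<theta> ^ m" by simp
  qed simp
  have "((\<lambda>\<theta>. \<bar>cos \<theta>\<bar> * sin \<theta> ^ m) has_integral 1 / real (m + 1) + 1 / real (m + 1)) {0..pi}"
    by (rule has_integral_combine[OF _ _ 1 2]) auto
  then have "((\<lambda>\<theta>. \<bar>s\<bar> * (\<bar>cos \<theta>\<bar> * sin \<theta> ^ m)) has_integral \<bar>s\<bar> * (2 / real (m + 1))) {0..pi}"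
    by (intro has_integral_mult_right) simp
  then have "integral {0..pi} (\<lambda>\<theta>. \<bar>s * cos \<theta>\<bar> * sin \<theta> ^ m) = \<bar>s\<bar> * (2 / real (m + 1))"
    unfolding abs_mult mult.assoc by (rule integral_unique)
  then have "cos_avg m abs s = \<bar>s\<bar> * (2 / (real m + 1)) / trig_int 0 m"
    by (simp add: cos_avg_def add.commute)
  moreover have "Gamma ((real m + 3) / 2) = (real m + 1) / 2 * Gamma ((real m + 1) / 2)"
    using Gamma_plus1[of "(real m + 1) / 2"] nonpos_Ints_nonpos[of "(real m + 1) / 2"]
    by (force simp: field_simps)
  moreover have "Gamma ((real m + 1) / 2) > 0" by (intro Gamma_real_pos) simp
  ultimately show ?thesis
    unfolding trig_int_Gamma by (simp only:) (simp add: divide_simps)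
qed

text \<open>Where the integrand does not vanish, \<open>\<bar>cos \<theta>\<bar> \<le> 1/2\<close> and hence \<open>1 \<le> 2 * sin \<theta>\<close>; the
  remaining integrand is dominated by the derivative of an arctangent.\<close>

lemma cos_avg_decay:
  fixes h :: "real \<Rightarrow> real"
  assumes h: "continuous_on UNIV h" and R: "R > 0" and z: "\<And>t. R \<le> \<bar>t\<bar> \<Longrightarrow> h t = 0"
  obtains C where "\<And>s. s \<ge> 2 * R \<Longrightarrow> \<bar>cos_avg m h s\<bar> \<le> C / s"
proof -
  have "bounded (h ` {-R..R})"
    by (intro compact_imp_bounded compact_continuous_image continuous_on_subset[OF h]) auto
  then obtain D where D: "D > 0" "\<And>t. t \<in> {-R..R} \<Longrightarrow> \<bar>h t\<bar> \<le> D"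
    unfolding bounded_pos by auto
  show thesis
  proof
    fix s assume s: "s \<ge> 2 * R"
    then have s0: "s > 0" using R by simp
    \<comment> \<open>The 4 is 2 * 2: one factor from 1 <= 2 sin \<theta>, one from the denominator
      being at most 2 where |s cos \<theta>| < R. The factor sin \<theta>, which the integrand lacks
      for m = 0, is what makes this an exact derivative.\<close>
    let ?k = "\<lambda>\<theta>. 4 * D * sin \<theta> / (1 + (s * cos \<theta> / R)\<^sup>2)"
    have pos: "1 + y\<^sup>2 > 0" for y :: real by (simp add: add_pos_nonneg)
    have k: "(?k has_integral (- (4 * D * R / s) * arctan (s * cos pi / R) - - (4 * D * R / s) * arctan (s * cos 0 / R))) {0..pi}"
    proof (rule fundamental_theorem_of_calculus)
      fix \<theta> :: real
      have "((\<lambda>\<theta>. - (4 * D * R / s) * arctan (s * cos \<theta> / R)) has_real_derivative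
          - (4 * D * R / s) * ((s * (- sin \<theta>) / R) / (1 + (s * cos \<theta> / R)\<^sup>2))) (at \<theta> within {0..pi})"
        by (rule derivative_eq_intros refl | simp add: R pos less_imp_neq[symmetric] divide_inverse)+
      moreover have "- (4 * D * R / s) * ((s * (- sin \<theta>) / R) / (1 + (s * cos \<theta> / R)\<^sup>2)) = ?k \<theta>"
        using s0 R by simp
      ultimately show "((\<lambda>\<theta>. - (4 * D * R / s) * arctan (s * cos \<theta> / R)) has_vector_derivative ?k \<theta>) (at \<theta> within {0..pi})"
        by (simp add: has_real_derivative_iff_has_vector_derivative)
    qed simp
    have "norm (integral {0..pi} (\<lambda>\<theta>. h (s * cos \<theta>) * sin \<theta> ^ m)) \<le> integral {0..pi} ?k"
    proof (rule integral_norm_bound_integral[OF cos_avg_integrable[OF h]])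
      show "?k integrable_on {0..pi}" using k by blast
      fix \<theta> assume \<theta>: "\<theta> \<in> {0..pi}"
      then have sin0: "sin \<theta> \<ge> 0" by (auto intro: sin_ge_zero)
      show "norm (h (s * cos \<theta>) * sin \<theta> ^ m) \<le> ?k \<theta>"
      proof (cases "R \<le> \<bar>s * cos \<theta>\<bar>")
        case True
        then show ?thesis using z sin0 D by (simp add: add_nonneg_nonneg)
      next
        case False
        have "2 * R * \<bar>cos \<theta>\<bar> \<le> s * \<bar>cos \<theta>\<bar>" using s by (intro mult_right_mono) auto
        also have "\<dots> < R" using False s0 by (simp add: abs_mult)
        finally have "\<bar>cos \<theta>\<bar> < 1/2" using R by simp
        then have "(cos \<theta>)\<^sup>2 \<le> (1/2)\<^sup>2" by (intro abs_le_square_iff[THEN iffD1]) simp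
        then have "(1/2)\<^sup>2 \<le> (sin \<theta>)\<^sup>2" unfolding sin_squared_eq by (simp add: power2_eq_square)
        then have sin2: "1 \<le> 2 * sin \<theta>" using power2_le_imp_le[OF _ sin0, of "1/2"] by simp
        have "\<bar>s * cos \<theta> / R\<bar> \<le> 1" using False R by simp
        then have "(s * cos \<theta> / R)\<^sup>2 \<le> 1" by (simp add: abs_square_le_1)
        then have den: "1 + (s * cos \<theta> / R)\<^sup>2 \<le> 2" by simp
        have "\<bar>h (s * cos \<theta>)\<bar> * \<bar>sin \<theta>\<bar> ^ m \<le> D * 1"
        proof (intro mult_mono power_le_one D(2))
          show "s * cos \<theta> \<in> {-R..R}" using False by (auto simp: not_le abs_less_iff)
        qed (use D in auto)
        also have "\<dots> \<le> D * (2 * sin \<theta>)" using sin2 D by simp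
        also have "\<dots> = 4 * D * sin \<theta> / 2" by simp
        also have "\<dots> \<le> ?k \<theta>"
          using den D sin0 by (intro divide_left_mono mult_pos_pos pos) auto
        finally show ?thesis by (simp add: abs_mult power_abs)
      qed
    qed
    also have "\<dots> = 8 * D * R / s * arctan (s / R)"
      using k by (simp add: integral_unique arctan_minus)
    also have "\<dots> \<le> 8 * D * R / s * 2"
      using arctan_ubound[of "s / R"] pi_less_4 D R s0 by (intro mult_left_mono) auto
    finally show "\<bar>cos_avg m h s\<bar> \<le> (16 * D * R / trig_int 0 m) / s"
      using trig_int_0_pos[of m] s0 by (simp add: cos_avg_def divide_simps mult_ac)
  qed
qed

text \<open>Evenness carries the one-sided bound to negative arguments, because
  \<open>at_infinity\<close> on the reals covers both ends.\<close>

lemma cos_avg_decay_limits: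
  fixes h :: "real \<Rightarrow> real"
  assumes h: "continuous_on UNIV h" and R: "R > 0" and z: "\<And>t. R \<le> \<bar>t\<bar> \<Longrightarrow> h t = 0"
    and even: "\<And>t. h (- t) = h t"
  shows "(cos_avg m h \<longlongrightarrow> 0) at_infinity" "cos_avg m h \<in> O[at_top](\<lambda>s. 1 / s)"
proof -
  obtain C where C: "\<And>s. s \<ge> 2 * R \<Longrightarrow> \<bar>cos_avg m h s\<bar> \<le> C / s"
    using cos_avg_decay[OF h R z] by blast
  have ev: "cos_avg m h \<bar>s\<bar> = cos_avg m h s" for s
    using even by (auto simp: cos_avg_def abs_if)
  have C': "\<bar>cos_avg m h s\<bar> \<le> C * \<bar>inverse s\<bar>" if "2 * R \<le> \<bar>s\<bar>" for s
    using C[OF that] by (simp add: ev divide_inverse)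
  show "cos_avg m h \<in> O[at_top](\<lambda>s. 1 / s)"
  proof (rule bigoI)
    show "\<forall>\<^sub>F s in at_top. norm (cos_avg m h s) \<le> C * norm (1 / s)"
      using eventually_ge_at_top[of "2 * R"] by eventually_elim (use C' in \<open>simp add: divide_inverse\<close>)
  qed
  show "(cos_avg m h \<longlongrightarrow> 0) at_infinity"
  proof (rule Lim_null_comparison)
    show "\<forall>\<^sub>F s in at_infinity. norm (cos_avg m h s) \<le> C * \<bar>inverse s\<bar>"
      unfolding eventually_at_infinity using C' by auto
    show "((\<lambda>s::real. C * \<bar>inverse s\<bar>) \<longlongrightarrow> 0) at_infinity"
      by (intro tendsto_mult_right_zero tendsto_rabs_zero tendsto_inverse_0)
  qed
qed

section \<open>Transfer of the properties of the profile to its spherical average\<close>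

locale ridge_average = bounded_borel_measure M B + even_bump u R
  for M :: "(real^'d) measure" and B u R +
  assumes mass: "measure M (space M) = 1"
    and second_moment: "(\<integral>\<xi>. (x \<bullet> \<xi>)\<^sup>2 \<partial>M) \<le> (norm x)\<^sup>2"
begin

definition avg :: "real^'d \<Rightarrow> real" where
  "avg x = (\<integral>\<xi>. - abs_conv u (x \<bullet> \<xi>) \<partial>M)"

lemma int_abs_conv [simp]: "integrable M (\<lambda>\<xi>. abs_conv u (x \<bullet> \<xi>))"
  by (intro integrable_continuous continuous_on_compose_UNIV[OF abs_conv_continuous] continuous_intros)

lemma int_square [simp]: "integrable M (\<lambda>\<xi>. (x \<bullet> \<xi>)\<^sup>2)"
  by (intro integrable_continuous continuous_intros)

text \<open>Two derivatives of the profile lead to - 2 u, which contributes the remaining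
  \<open>n\<close>.\<close>

lemma avg_Ck:
  assumes "Ck n u" shows "Ck (n + 2) avg"
proof -
  have "Ck n (\<lambda>s. - 2 * u s)" using assms by (rule Ck_cmult)
  moreover have d: "((\<lambda>s. - abs_conv u s) has_real_derivative - abs_conv' s) (at s)"
    "((\<lambda>s. - abs_conv' s) has_real_derivative - 2 * u s) (at s)" for s
    by (auto intro!: derivative_eq_intros abs_conv_deriv abs_conv'_deriv)
  ultimately have "Ck (Suc (Suc n)) (\<lambda>s. - abs_conv u s)"
    unfolding Ck_Suc_real[OF d(1)] Ck_Suc_real[OF d(2)] by blast
  from Ck_integral_ridge[OF this, of "\<lambda>_. 1"] show ?thesis
    by (simp add: avg_def[abs_def] del: Ck.simps)
qed

text \<open>For each fixed \<xi> the numbers x_j . \<xi> are points of the line, so the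
  one-dimensional inequality can be integrated.\<close>

lemma avg_CP1:
  assumes "Ck n u" and C: "\<And>\<omega>. cos_transform \<omega> \<ge> 0"
  shows "avg \<in> CP1"
proof (rule CP1_I)
  show "continuous_on UNIV avg" using avg_Ck[OF assms(1)] by (rule Ck_imp_continuous)
  show "avg (- x) = avg x" for x by (simp add: avg_def abs_conv_even)
  fix N :: nat and x :: "nat \<Rightarrow> real^'d" and \<alpha> :: "nat \<Rightarrow> real"
  assume \<alpha>: "(\<Sum>j<N. \<alpha> j) = 0"
  have "(\<Sum>j<N. \<Sum>k<N. \<alpha> j * \<alpha> k * avg (x j - x k)) =
      (\<integral>\<xi>. - (\<Sum>j<N. \<Sum>k<N. \<alpha> j * \<alpha> k * abs_conv u (x j \<bullet> \<xi> - x k \<bullet> \<xi>)) \<partial>M)"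
    by (simp add: avg_def sum_negf inner_diff_left[symmetric])
  also have "\<dots> \<ge> 0"
    using abs_conv_neg_type[OF C \<alpha>] by (intro Bochner_Integration.integral_nonneg) simp
  finally show "(\<Sum>j<N. \<Sum>k<N. \<alpha> j * \<alpha> k * avg (x j - x k)) \<ge> 0" .
qed

lemma avg_neg: "avg x < 0"
proof -
  have "avg x \<le> (\<integral>\<xi>. - abs_conv u 0 \<partial>M)"
    unfolding avg_def by (rule integral_mono) (auto simp: abs_conv_ge_0)
  also have "\<dots> < 0" using mass abs_conv_0_pos by simp
  finally show ?thesis .
qed

lemma avg_concave: "concave_on UNIV avg"
  unfolding concave_on_def
proof (rule convex_onI)
  fix t :: real and x y assume t: "0 < t" "t < 1"
  have "- avg ((1 - t) *\<^sub>R x + t *\<^sub>R y) \<le> (\<integral>\<xi>. (1 - t) * abs_conv u (x \<bullet> \<xi>) + t * abs_conv u (y \<bullet> \<xi>) \<partial>M)"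
    unfolding avg_def Bochner_Integration.integral_minus minus_minus
    using convex_onD[OF abs_conv_convex, of t] t
    by (intro integral_mono Bochner_Integration.integrable_add integrable_mult_right int_abs_conv)
       (simp add: inner_add_left)
  then show "- avg ((1 - t) *\<^sub>R x + t *\<^sub>R y) \<le> (1 - t) * - avg x + t * - avg y"
    by (simp add: avg_def)
qed simp

lemma sup_norm_nonneg: "sup_norm u \<ge> 0"
  using le_sup_norm[of 0] u_nonneg[of 0] by simp

lemma avg_semiconvex:
  assumes t: "0 \<le> t" "t \<le> 1"
  shows "avg (t *\<^sub>R x + (1 - t) *\<^sub>R y) \<le> t * avg x + (1 - t) * avg y + sup_norm u * t * (1 - t) * (norm (x - y))\<^sup>2"
proof -
  let ?f = "\<lambda>s. - abs_conv u s"
  \<comment> \<open>Convexity of \<open>sup_norm u\<close> s^2 plus the profile; the quadratic part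
    produces t (1 - t) (a - b)^2 as its exact convexity gap.\<close>
  have f: "?f (t * a + (1 - t) * b) \<le> t * ?f a + (1 - t) * ?f b + sup_norm u * t * (1 - t) * (a - b)\<^sup>2" for a b
    using convex_onD[OF semiconvex, of "1 - t" a b] t by (simp add: algebra_simps power2_eq_square)
  have "avg (t *\<^sub>R x + (1 - t) *\<^sub>R y) \<le>
      (\<integral>\<xi>. t * ?f (x \<bullet> \<xi>) + (1 - t) * ?f (y \<bullet> \<xi>) + sup_norm u * t * (1 - t) * ((x - y) \<bullet> \<xi>)\<^sup>2 \<partial>M)"
    unfolding avg_def
  proof (rule integral_mono)
    fix \<xi>
    show "?f ((t *\<^sub>R x + (1 - t) *\<^sub>R y) \<bullet> \<xi>) \<le> t * ?f (x \<bullet> \<xi>) + (1 - t) * ?f (y \<bullet> \<xi>) + sup_norm u * t * (1 - t) * ((x - y) \<bullet> \<xi>)\<^sup>2"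
      using f[of "x \<bullet> \<xi>" "y \<bullet> \<xi>"] by (simp add: inner_add_left inner_diff_left)
  qed auto
  also have "\<dots> = t * avg x + (1 - t) * avg y + sup_norm u * t * (1 - t) * (\<integral>\<xi>. ((x - y) \<bullet> \<xi>)\<^sup>2 \<partial>M)"
    by (simp add: avg_def)
  also have "\<dots> \<le> t * avg x + (1 - t) * avg y + sup_norm u * t * (1 - t) * (norm (x - y))\<^sup>2"
    using second_moment[of "x - y"] sup_norm_nonneg t by (intro add_left_mono mult_left_mono) auto
  finally show ?thesis .
qed

text \<open>Pairing with a vector turns the coordinatewise \<open>grad\<close> into one scalar
  integral, as the Lipschitz estimate needs.\<close>

lemma avg_grad_inner: "grad avg x \<bullet> v = (\<integral>\<xi>. - abs_conv' (x \<bullet> \<xi>) * (v \<bullet> \<xi>) \<partial>M)"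
proof -
  have "((\<lambda>s. - abs_conv u s) has_real_derivative - abs_conv' s) (at s)" for s
    by (auto intro!: derivative_eq_intros abs_conv_deriv)
  moreover have "continuous_on UNIV (\<lambda>s. - abs_conv' s)"
    using abs_conv'_deriv by (intro continuous_intros) (meson DERIV_isCont continuous_at_imp_continuous_on)
  ultimately have D: "(avg has_derivative (\<lambda>v. \<integral>\<xi>. - abs_conv' (x \<bullet> \<xi>) * (v \<bullet> \<xi>) \<partial>M)) (at x)"
    using has_derivative_integral_ridge[of "\<lambda>s. - abs_conv u s" "\<lambda>s. - abs_conv' s" "\<lambda>_. 1" x]
    by (simp add: avg_def[abs_def])
  note fd = frechet_derivative_at[OF D]
  have "linear (frechet_derivative avg (at x))"
    using D by (metis fd has_derivative_linear)
  then have "frechet_derivative avg (at x) (\<Sum>i\<in>UNIV. v $ i *\<^sub>R axis i 1) = (\<Sum>i\<in>UNIV. v $ i * frechet_derivative avg (at x) (axis i 1))"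
    by (simp add: linear_sum linear_cmul)
  moreover have "(\<Sum>i\<in>UNIV. v $ i *\<^sub>R axis i 1) = v"
    using basis_expansion[of v] by (simp add: scalar_mult_eq_scaleR)
  ultimately have "grad avg x \<bullet> v = frechet_derivative avg (at x) v"
    by (simp add: grad_def inner_vec_def mult.commute)
  then show ?thesis by (simp add: fd[symmetric])
qed

text \<open>Tests the difference of gradients against itself. The Lipschitz bound for
  \<open>abs_conv'\<close> gives the mean of |(x - y) . \<xi>| |v . \<xi>|, which is at most |x - y|
  |v|; one factor |v| then cancels.\<close>

lemma avg_grad_lipschitz: "norm (grad avg x - grad avg y) \<le> 2 * sup_norm u * norm (x - y)"
proof -
  define v where "v = grad avg x - grad avg y"
  have ic: "integrable M (\<lambda>\<xi>. abs_conv' (x \<bullet> \<xi>) * (w \<bullet> \<xi>))" for x w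
    using abs_conv'_deriv by (intro integrable_ridge continuous_intros) (meson DERIV_isCont continuous_at_imp_continuous_on)
  have ii: "integrable M (\<lambda>\<xi>. \<bar>a \<bullet> \<xi>\<bar> * \<bar>b \<bullet> \<xi>\<bar>)" for a b
    by (intro integrable_continuous continuous_intros)
  \<comment> \<open>Cauchy-Schwarz in the form of 2ab <= a^2 + b^2 for unit vectors, extended by
    scaling in \<open>cs'\<close>.\<close>
  have cs: "(\<integral>\<xi>. \<bar>a \<bullet> \<xi>\<bar> * \<bar>b \<bullet> \<xi>\<bar> \<partial>M) \<le> 1" if "norm a = 1" "norm b = 1" for a b
  proof -
    have "(\<integral>\<xi>. \<bar>a \<bullet> \<xi>\<bar> * \<bar>b \<bullet> \<xi>\<bar> \<partial>M) \<le> (\<integral>\<xi>. ((a \<bullet> \<xi>)\<^sup>2 + (b \<bullet> \<xi>)\<^sup>2) / 2 \<partial>M)"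
    proof (rule integral_mono[OF ii])
      fix \<xi>
      show "\<bar>a \<bullet> \<xi>\<bar> * \<bar>b \<bullet> \<xi>\<bar> \<le> ((a \<bullet> \<xi>)\<^sup>2 + (b \<bullet> \<xi>)\<^sup>2) / 2"
        using sum_squares_bound[of "\<bar>a \<bullet> \<xi>\<bar>" "\<bar>b \<bullet> \<xi>\<bar>"] by simp
    qed simp
    also have "\<dots> \<le> 1" using second_moment[of a] second_moment[of b] that by simp
    finally show ?thesis .
  qed
  have cs': "(\<integral>\<xi>. \<bar>a \<bullet> \<xi>\<bar> * \<bar>b \<bullet> \<xi>\<bar> \<partial>M) \<le> norm a * norm b" for a b
  proof (cases "a = 0 \<or> b = 0")
    case False
    then have "(\<integral>\<xi>. \<bar>sgn a \<bullet> \<xi>\<bar> * \<bar>sgn b \<bullet> \<xi>\<bar> \<partial>M) \<le> 1"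
      by (intro cs) (auto simp: norm_sgn)
    moreover have "(\<lambda>\<xi>. \<bar>sgn a \<bullet> \<xi>\<bar> * \<bar>sgn b \<bullet> \<xi>\<bar>) = (\<lambda>\<xi>. \<bar>a \<bullet> \<xi>\<bar> * \<bar>b \<bullet> \<xi>\<bar> / (norm a * norm b))"
      by (auto simp: sgn_div_norm abs_mult divide_inverse)
    ultimately show ?thesis using False by (simp add: divide_le_eq)
  qed auto
  have "(norm v)\<^sup>2 = grad avg x \<bullet> v - grad avg y \<bullet> v"
    by (simp add: v_def power2_norm_eq_inner inner_diff_left)
  also have "\<dots> = (\<integral>\<xi>. (abs_conv' (y \<bullet> \<xi>) - abs_conv' (x \<bullet> \<xi>)) * (v \<bullet> \<xi>) \<partial>M)"
    unfolding avg_grad_inner left_diff_distrib using ic by simp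
  also have "\<dots> \<le> (\<integral>\<xi>. 2 * sup_norm u * (\<bar>(x - y) \<bullet> \<xi>\<bar> * \<bar>v \<bullet> \<xi>\<bar>) \<partial>M)"
  proof (rule integral_mono)
    fix \<xi>
    have "(abs_conv' (y \<bullet> \<xi>) - abs_conv' (x \<bullet> \<xi>)) * (v \<bullet> \<xi>) \<le> \<bar>abs_conv' (x \<bullet> \<xi>) - abs_conv' (y \<bullet> \<xi>)\<bar> * \<bar>v \<bullet> \<xi>\<bar>"
      by (metis abs_ge_self abs_minus_commute abs_mult)
    also have "\<dots> \<le> 2 * sup_norm u * \<bar>x \<bullet> \<xi> - y \<bullet> \<xi>\<bar> * \<bar>v \<bullet> \<xi>\<bar>"
      by (intro mult_right_mono abs_conv'_lipschitz) auto
    finally show "(abs_conv' (y \<bullet> \<xi>) - abs_conv' (x \<bullet> \<xi>)) * (v \<bullet> \<xi>) \<le> 2 * sup_norm u * (\<bar>(x - y) \<bullet> \<xi>\<bar> * \<bar>v \<bullet> \<xi>\<bar>)"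
      by (simp add: inner_diff_left mult.assoc)
  qed (use ic ii in \<open>auto simp: left_diff_distrib\<close>)
  also have "\<dots> \<le> 2 * sup_norm u * (norm (x - y) * norm v)"
    using cs'[of "x - y" v] sup_norm_nonneg by (simp add: mult_left_mono)
  finally have "norm v * norm v \<le> (2 * sup_norm u * norm (x - y)) * norm v"
    by (simp add: power2_eq_square mult_ac)
  then show ?thesis
    using sup_norm_nonneg unfolding v_def[symmetric] by (cases "v = 0") auto
qed

end

section \<open>Assembly of the six claims\<close>

lemma U_class_even_bump:
  assumes "u \<in> U_class n" obtains R where "even_bump u R"
proof -
  have "bounded (closure {x. u x \<noteq> 0})"
    using assms by (auto simp: U_class_def compact_imp_bounded)
  then have "bounded {x. u x \<noteq> 0}" by (rule bounded_subset) (rule closure_subset)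
  then obtain R where R: "R > 0" "\<And>x. u x \<noteq> 0 \<Longrightarrow> \<bar>x\<bar> \<le> R"
    unfolding bounded_pos by auto
  \<comment> \<open>\<open>R\<close> only bounds the points where \<open>u\<close> is nonzero,
    possibly with equality, whereas the locale requires \<open>u\<close> to vanish at its radius
    too; hence R + 1.\<close>
  have "even_bump u (R + 1)"
  proof
    show "u t = 0" if "R + 1 \<le> \<bar>t\<bar>" for t using R(2)[of t] that by auto
  qed (use assms R in \<open>auto simp: U_class_def intro: Ck_imp_continuous\<close>)
  then show thesis by (rule that)
qed

theorem mainTheorem10:
  fixes n :: nat and u :: "real \<Rightarrow> real" and f F :: "real \<Rightarrow> real"
    and \<Phi> :: "real^'d \<Rightarrow> real"
  assumes d2: "CARD('d) \<ge> 2"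
    and u: "u \<in> U_class n"
    and f_def: "f = (\<lambda>s. - abs_conv u s)"
    and F_def: "F = I_op CARD('d) f"
    and Phi_def: "\<Phi> = (\<lambda>x. F (norm x))"
  shows "\<Phi> \<in> CP1
    \<and> (\<forall>x. \<Phi> x < 0)
    \<and> (\<exists>\<phi> :: real \<Rightarrow> real. continuous_on UNIV \<phi> \<and> (\<phi> \<longlongrightarrow> 0) at_infinity
           \<and> \<phi> \<in> O[at_top](\<lambda>s. 1 / s)
           \<and> (\<forall>x. \<Phi> x = - (Gamma (real CARD('d) / 2) / (sqrt pi * Gamma ((real CARD('d) + 1) / 2))) * norm x
                        + \<phi> (norm x)))
    \<and> (Ck (n + 2) \<Phi>)
    \<and> (lipschitz_on (2 * sqrt (real CARD('d)) * sup_norm u) UNIV (grad \<Phi>))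
    \<and> (concave_on UNIV \<Phi>)
    \<and> (\<forall>lam::real. \<forall>x y. 0 \<le> lam \<and> lam \<le> 1 \<longrightarrow>
           \<Phi> (lam *\<^sub>R x + (1 - lam) *\<^sub>R y) \<le> lam * \<Phi> x + (1 - lam) * \<Phi> y
             + (2 * sqrt (real CARD('d)) * sup_norm u) / 2 * lam * (1 - lam) * (norm (x - y))\<^sup>2)"
proof -
  obtain R where "even_bump u R" using U_class_even_bump[OF u] .
  then interpret even_bump u R .
  obtain M :: "(real^'d) measure" and B where M: "finite_measure M" "sets M = sets borel"
    "AE \<xi> in M. norm \<xi> \<le> B" "B > 0"
    and rep: "\<And>h x. continuous_on UNIV h \<Longrightarrow> (\<integral>\<xi>. h (x \<bullet> \<xi>) \<partial>M) = cos_avg (CARD('d) - 2) h (norm x)"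
    using sphere_measure_exists[OF d2] by metis
  define m where "m = CARD('d) - 2"
  have md: "CARD('d) = m + 2" using d2 by (simp add: m_def)
  interpret finite_measure M by fact
  interpret ridge_average M B u R
  \<comment> \<open>Total mass and second moment are read off from the representation with h = 1 and
    h = t^2.\<close>
  proof
    show "measure M (space M) = 1"
      using rep[of "\<lambda>_. 1"] by (simp add: cos_avg_const)
    show "(\<integral>\<xi>. (x \<bullet> \<xi>)\<^sup>2 \<partial>M) \<le> (norm x)\<^sup>2" for x
      using rep[of "\<lambda>t. t\<^sup>2" x] by (simp add: cos_avg_square_le continuous_intros)
  qed (use M in auto)
  have fc: "continuous_on UNIV f" unfolding f_def by (intro continuous_intros abs_conv_continuous)
  have F: "F s = cos_avg m f s" for s
    unfolding F_def m_def by (rule I_op_eq_cos_avg[OF d2 fc]) (simp add: f_def abs_conv_even)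
  have Phi: "\<Phi> = avg"
    unfolding Phi_def F using rep[OF fc] by (auto simp: m_def avg_def f_def)
  \<comment> \<open>The compactly supported remainder; its angular average is the witness for
    \<phi>, while the average of |t| gives the linear term.\<close>
  let ?h = "\<lambda>t. \<bar>t\<bar> - abs_conv u t"
  have hc: "continuous_on UNIV ?h" by (intro continuous_intros abs_conv_continuous)
  have hz: "?h t = 0" if "R \<le> \<bar>t\<bar>" for t using abs_conv_eq_abs[OF that] by simp
  have he: "?h (- t) = ?h t" for t by (simp add: abs_conv_even)
  have "\<Phi> x = - (Gamma (real CARD('d) / 2) / (sqrt pi * Gamma ((real CARD('d) + 1) / 2))) * norm x
      + cos_avg m ?h (norm x)" for x
  proof -
    have "\<Phi> x = - cos_avg m (abs_conv u) (norm x)"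
      by (simp add: Phi_def F f_def cos_avg_minus)
    moreover have "cos_avg m ?h (norm x) = cos_avg m abs (norm x) - cos_avg m (abs_conv u) (norm x)"
      by (intro cos_avg_diff abs_conv_continuous continuous_intros)
    ultimately show ?thesis by (simp add: cos_avg_abs md add.commute)
  qed
  then have asymp: "\<exists>\<phi> :: real \<Rightarrow> real. continuous_on UNIV \<phi> \<and> (\<phi> \<longlongrightarrow> 0) at_infinity
      \<and> \<phi> \<in> O[at_top](\<lambda>s. 1 / s)
      \<and> (\<forall>x. \<Phi> x = - (Gamma (real CARD('d) / 2) / (sqrt pi * Gamma ((real CARD('d) + 1) / 2))) * norm x
                        + \<phi> (norm x))"
    using cos_avg_cont[OF hc] cos_avg_decay_limits[OF hc R_pos hz he] by blast
  have Ck_u: "Ck n u" using u by (simp add: U_class_def)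
  have "cos_transform \<omega> \<ge> 0" for \<omega>
  proof -
    have "0 \<le> Re (fourier u (\<omega> / (2 * pi)))" using u unfolding U_class_def by blast
    then show ?thesis by (simp add: Re_fourier)
  qed
  then have CP: "\<Phi> \<in> CP1" unfolding Phi using Ck_u by (intro avg_CP1)
  \<comment> \<open>Passes from the factor 1 obtained by averaging to the stated sqrt d, for both
    the gradient and the semiconvexity estimate.\<close>
  have S: "sup_norm u \<le> sqrt (real CARD('d)) * sup_norm u"
    using sup_norm_nonneg d2 by (simp add: mult_le_cancel_right1)
  have lip: "lipschitz_on (2 * sqrt (real CARD('d)) * sup_norm u) UNIV (grad \<Phi>)"
    unfolding Phi
  proof (rule lipschitz_onI)
    fix x y :: "real^'d"
    have "dist (grad avg x) (grad avg y) \<le> 2 * sup_norm u * norm (x - y)"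
      unfolding dist_norm by (rule avg_grad_lipschitz)
    also have "\<dots> \<le> 2 * sqrt (real CARD('d)) * sup_norm u * norm (x - y)"
      using S by (intro mult_right_mono[OF _ norm_ge_zero]) simp
    finally show "dist (grad avg x) (grad avg y) \<le> 2 * sqrt (real CARD('d)) * sup_norm u * dist x y"
      by (simp add: dist_norm)
  qed (simp add: sup_norm_nonneg)
  have semi: "\<Phi> (t *\<^sub>R x + (1 - t) *\<^sub>R y) \<le> t * \<Phi> x + (1 - t) * \<Phi> y
      + (2 * sqrt (real CARD('d)) * sup_norm u) / 2 * t * (1 - t) * (norm (x - y))\<^sup>2"
    if t: "0 \<le> t \<and> t \<le> 1" for t x y
  proof -
    have "\<Phi> (t *\<^sub>R x + (1 - t) *\<^sub>R y) \<le> t * \<Phi> x + (1 - t) * \<Phi> y + sup_norm u * t * (1 - t) * (norm (x - y))\<^sup>2"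
      unfolding Phi using t by (intro avg_semiconvex) auto
    also have "\<dots> \<le> t * \<Phi> x + (1 - t) * \<Phi> y + (2 * sqrt (real CARD('d)) * sup_norm u) / 2 * t * (1 - t) * (norm (x - y))\<^sup>2"
      using S t by (intro add_left_mono mult_right_mono) auto
    finally show ?thesis .
  qed
  show ?thesis
    using CP asymp lip semi avg_neg avg_Ck[OF Ck_u] avg_concave unfolding Phi by blast
qed

end
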